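(* For any $(r,s)\in\mathbb{C}^2\setminus\frac12\mathbb{Z}^2$, the following identities of meromorphic functions of $\tau\in\mathbb{H}$ hold: (i) $Z^{(\mathbf m_1)}(r,s,\tau)=4\,Z\big(r,\frac s2,2\tau\big)\cdot Z\big(r,\frac{s+1}{2},2\tau\big)$; (ii) $Z^{(\mathbf m_2)}(r,s,\tau)=Z\big(\frac r2,s,\frac\tau2\big)\cdot Z\big(\frac{r+1}{2},s,\frac\tau2\big)$; (iii) $Z^{(\mathbf m_3)}(r,s,\tau)=Z\big(\frac{r-s}{2},s,\frac{1+\tau}{2}\big)\cdot Z\big(\frac{r-s+1}{2},s,\frac{1+\tau}{2}\big)$.
   Context: For $\tau\in\mathbb{H}$ (upper half plane): $\omega_1=1$, $\omega_2=\tau$, $\omega_3=1+\tau$, $\Lambda_\tau=\mathbb{Z}\oplus\mathbb{Z}\tau$; $\wp(z|\tau),\zeta(z|\tau)$ are the Weierstrass functions of $\Lambda_\tau$, $e_k(\tau)=\wp(\frac{\omega_k}{2}|\tau)$, $\zeta(z+\omega_i|\tau)=\zeta(z|\tau)+\eta_i(\tau)$. Define $Z(r,s,\tau)=\zeta(r+s\tau|\tau)-r\eta_1(\tau)-s\eta_2(\tau)$ and, for $k=1,2,3$, $Z^{(\mathbf m_k)}(r,s,\tau)=Z(r,s,\tau)^2-\wp(r+s\tau|\tau)+e_k(\tau)$. *)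

theory Defs
  imports "HOL-Complex_Analysis.Complex_Analysis"
begin

definition upper_half_plane :: "complex set" where
  "upper_half_plane = {\<tau>. Im \<tau> > 0}"

definition period_lattice :: "complex \<Rightarrow> complex set" where
  "period_lattice \<tau> = {of_int m + of_int n * \<tau> | m n :: int. True}"

(* The indices in use are k = 1, 2, 3; every other index gives the junk value 1 + \<tau>. *)
definition omega :: "nat \<Rightarrow> complex \<Rightarrow> complex" where
  "omega k \<tau> = (if k = 1 then 1 else if k = 2 then \<tau> else 1 + \<tau>)"

(* For Im \<tau> > 0 the two series below converge absolutely at every z outside
   the lattice.  At lattice points, where the functions have poles, the values are junk. *)
definition weierstrass_p :: "complex \<Rightarrow> complex \<Rightarrow> complex" where
  "weierstrass_p z \<tau> =
     1 / z ^ 2 + (\<Sum>\<^sub>\<infinity>w\<in>period_lattice \<tau> - {0}. 1 / (z - w) ^ 2 - 1 / w ^ 2)"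

definition weierstrass_zeta :: "complex \<Rightarrow> complex \<Rightarrow> complex" where
  "weierstrass_zeta z \<tau> =
     1 / z + (\<Sum>\<^sub>\<infinity>w\<in>period_lattice \<tau> - {0}. 1 / (z - w) + 1 / w + z / w ^ 2)"

definition e_val :: "nat \<Rightarrow> complex \<Rightarrow> complex" where
  "e_val k \<tau> = weierstrass_p (omega k \<tau> / 2) \<tau>"

definition quasi_period :: "nat \<Rightarrow> complex \<Rightarrow> complex" where
  "quasi_period i \<tau> = (THE \<eta>. \<forall>z. z \<notin> period_lattice \<tau> \<longrightarrow>
     weierstrass_zeta (z + omega i \<tau>) \<tau> = weierstrass_zeta z \<tau> + \<eta>)"

definition Z :: "complex \<Rightarrow> complex \<Rightarrow> complex \<Rightarrow> complex" where
  "Z r s \<tau> = weierstrass_zeta (r + s * \<tau>) \<tau> - r * quasi_period 1 \<tau> - s * quasi_period 2 \<tau>"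

definition Zm :: "nat \<Rightarrow> complex \<Rightarrow> complex \<Rightarrow> complex \<Rightarrow> complex" where
  "Zm k r s \<tau> = (Z r s \<tau>) ^ 2 - weierstrass_p (r + s * \<tau>) \<tau> + e_val k \<tau>"

(* Identity of meromorphic functions on A.  Since HOL functions are total, their values
   at poles are junk, so equality is required at every point outside a discrete set S. *)
definition meromorphic_identity ::
    "complex set \<Rightarrow> complex set \<Rightarrow> (complex \<Rightarrow> complex) \<Rightarrow> (complex \<Rightarrow> complex) \<Rightarrow> bool" where
  "meromorphic_identity A S f g \<longleftrightarrow>
     f meromorphic_on A \<and> g meromorphic_on A \<and> S sparse_in A \<and> (\<forall>\<tau>\<in>A - S. f \<tau> = g \<tau>)"

(* The \<tau> at which r + s \<tau> is a pole of the Weierstrass functions of the lattice of \<tau>.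
   The arguments of Z in the factored forms of Zm r s avoid their respective lattices
   whenever \<tau> lies outside this set. *)
definition pole_set :: "complex \<Rightarrow> complex \<Rightarrow> complex set" where
  "pole_set r s = {\<tau> \<in> upper_half_plane. r + s * \<tau> \<in> period_lattice \<tau>}"

end

theory Submission
  imports Defs
begin

text \<open>Let \<open>L \<subseteq> M = L \<union> (L + a)\<close> be lattices with \<open>2a \<in> L\<close>. The two factors \<open>A\<close>, \<open>B\<close> of the
  right-hand side are built from \<open>\<zeta>\<close> of \<open>L\<close> at \<open>x\<close> and \<open>x + a\<close>. Their sum is the function \<open>Z\<close> of \<open>M\<close>,
  because \<open>\<zeta>\<^sub>L(x) + \<zeta>\<^sub>L(x + a) - \<zeta>\<^sub>M(x)\<close> is affine in \<open>x\<close>. Their difference \<open>\<phi>\<close> changes sign under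
  \<open>x \<mapsto> x + a\<close>, so \<open>\<phi>\<^sup>2\<close> is elliptic for \<open>M\<close> with the same principal part as \<open>\<wp>\<^sub>M\<close>; since \<open>\<phi>\<close> is odd
  it vanishes at \<open>b / 2\<close> for \<open>b \<in> L\<close>, and Liouville's theorem gives \<open>\<phi>\<^sup>2 = \<wp>\<^sub>M - \<wp>\<^sub>M(b / 2)\<close>. Now use
  \<open>4AB = (A + B)\<^sup>2 - (A - B)\<^sup>2\<close> with \<open>(a, b)\<close> equal to \<open>(\<tau>, 1)\<close>, \<open>(1, \<tau>)\<close> and \<open>(1, 1 + \<tau>)\<close>.\<close>

subsection \<open>Lattices and the Weierstrass functions\<close>

definition zeta_term :: "complex \<Rightarrow> complex \<Rightarrow> complex" where
  "zeta_term z w = 1 / (z - w) + 1 / w + z / w ^ 2"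

definition wp_term :: "complex \<Rightarrow> complex \<Rightarrow> complex" where
  "wp_term z w = 1 / (z - w) ^ 2 - 1 / w ^ 2"

text \<open>Indexed by the lattice as a set and not by \<open>\<tau>\<close>, so that lattices that
  do not contain 1, such as 2\<int> + 2\<int>\<sigma>, are covered as well.\<close>

definition lattice_zeta :: "complex set \<Rightarrow> complex \<Rightarrow> complex" where
  "lattice_zeta L z = (\<Sum>\<^sub>\<infinity>w\<in>L. zeta_term z w)"

definition lattice_wp :: "complex set \<Rightarrow> complex \<Rightarrow> complex" where
  "lattice_wp L z = (\<Sum>\<^sub>\<infinity>w\<in>L. wp_term z w)"

text \<open>Over a common denominator the term is z^2 / (w^2 (z - w)), and |z - w| is at least |w| /
  2.\<close>

lemma norm_zeta_term_le:
  assumes "norm z \<le> R" "2 * R \<le> norm w" "w \<noteq> 0"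
  shows "norm (zeta_term z w) \<le> 2 * R ^ 2 / norm w ^ 3"
proof -
  have w: "norm w > 0" using assms by simp
  have d: "norm (z - w) \<ge> norm w / 2"
    using norm_triangle_ineq2[of w z] assms by (simp add: norm_minus_commute)
  then have zw: "z - w \<noteq> 0" using w by auto
  have "zeta_term z w = z ^ 2 / (w ^ 2 * (z - w))"
    unfolding zeta_term_def using zw assms(3) by (simp add: divide_simps) (simp add: power2_eq_square algebra_simps)
  then have "norm (zeta_term z w) = norm z ^ 2 / (norm w ^ 2 * norm (z - w))"
    by (simp add: norm_divide norm_mult norm_power)
  also have "\<dots> \<le> R ^ 2 / (norm w ^ 2 * (norm w / 2))"
    using assms d w by (intro frac_le mult_left_mono power_mono) auto
  also have "\<dots> = 2 * R ^ 2 / norm w ^ 3"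
    by (simp add: power2_eq_square power3_eq_cube field_simps)
  finally show ?thesis .
qed

text \<open>Over a common denominator the numerator is z (2w - z), which grows only linearly in w,
  against a denominator of order four.\<close>

lemma norm_wp_term_le:
  assumes "norm z \<le> R" "2 * R \<le> norm w" "w \<noteq> 0"
  shows "norm (wp_term z w) \<le> 10 * R / norm w ^ 3"
proof -
  have w: "norm w > 0" using assms by simp
  have d: "norm (z - w) \<ge> norm w / 2"
    using norm_triangle_ineq2[of w z] assms by (simp add: norm_minus_commute)
  then have zw: "z - w \<noteq> 0" using w by auto
  have "wp_term z w = z * (2 * w - z) / (w ^ 2 * (z - w) ^ 2)"
    unfolding wp_term_def using zw assms(3) by (simp add: divide_simps) (simp add: power2_eq_square algebra_simps)
  then have "norm (wp_term z w) = norm z * norm (2 * w - z) / (norm w ^ 2 * norm (z - w) ^ 2)"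
    by (simp add: norm_divide norm_mult norm_power)
  also have "\<dots> \<le> R * (5 / 2 * norm w) / (norm w ^ 2 * (norm w / 2) ^ 2)"
  proof (intro frac_le mult_left_mono mult_mono power_mono)
    show "norm (2 * w - z) \<le> 5 / 2 * norm w"
      using norm_triangle_ineq4[of "2 * w" z] assms by (simp add: norm_mult)
  qed (use assms d w order_trans[OF norm_ge_zero assms(1)] in auto)
  also have "\<dots> = 10 * R / norm w ^ 3"
    by (simp add: power2_eq_square power3_eq_cube field_simps)
  finally show ?thesis .
qed

lemma has_sum_diff_complex:
  fixes f g :: "'a \<Rightarrow> complex"
  assumes "(f has_sum a) A" "(g has_sum b) A"
  shows "((\<lambda>x. f x - g x) has_sum (a - b)) A"
proof -
  have "((\<lambda>x. - g x) has_sum (- b)) A" using assms(2) by (simp add: has_sum_uminus)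
  from has_sum_add[OF assms(1) this] show ?thesis by simp
qed

text \<open>Infinitely many nonzero values in a ball would each contribute at least 1 / R^3 to a
  convergent sum. Zeros need the second hypothesis, since 1 / 0 = 0 hides them from the sum. Stating
  this for a family serves both a lattice and its indexing by pairs of integers.\<close>

lemma finite_ball_if_summable_inverse_cube:
  fixes f :: "'a \<Rightarrow> complex"
  assumes "(\<lambda>i. 1 / norm (f i) ^ 3) summable_on I" "finite {i \<in> I. f i = 0}"
  shows "finite {i \<in> I. norm (f i) \<le> R}"
proof (rule ccontr)
  assume inf: "infinite {i \<in> I. norm (f i) \<le> R}"
  define A where "A = {i \<in> I. norm (f i) \<le> R} - {i \<in> I. f i = 0}"
  have A: "infinite A" unfolding A_def using inf assms(2) by (rule Diff_infinite_finite[rotated])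
  then obtain i where "i \<in> A" by (metis ex_in_conv finite.emptyI)
  then have R: "R > 0" unfolding A_def
    by (smt (verit, ccfv_SIG) DiffE mem_Collect_eq zero_less_norm_iff)
  have "(\<lambda>_. 1 / R ^ 3) summable_on A"
  proof (rule summable_on_comparison_test)
    show "(\<lambda>i. 1 / norm (f i) ^ 3) summable_on A"
      by (rule summable_on_subset[OF assms(1)]) (auto simp: A_def)
    fix i assume "i \<in> A"
    then show "1 / R ^ 3 \<le> 1 / norm (f i) ^ 3"
      using R by (intro divide_left_mono power_mono) (auto simp: A_def)
  qed (use R in auto)
  with infsum_diverge_constant[OF A, of "1 / R ^ 3"] R show False by simp
qed

text \<open>A lattice without a chosen basis: \<open>summable_inverse_cube\<close> gives convergence
  of the series and discreteness, and \<open>cocompact\<close> gives the bounded set of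
  representatives for Liouville's theorem.\<close>

locale complex_lattice =
  fixes L :: "complex set"
  assumes zero_mem: "0 \<in> L"
    and diff_mem: "x \<in> L \<Longrightarrow> y \<in> L \<Longrightarrow> x - y \<in> L"
    and summable_inverse_cube: "(\<lambda>w. 1 / norm w ^ 3) summable_on L"
    and cocompact: "\<exists>R. \<forall>z. \<exists>w\<in>L. norm (z - w) \<le> R"
begin

lemma uminus_mem: "x \<in> L \<Longrightarrow> - x \<in> L"
  using diff_mem[OF zero_mem] by simp

lemma add_mem: "x \<in> L \<Longrightarrow> y \<in> L \<Longrightarrow> x + y \<in> L"
  using diff_mem[OF _ uminus_mem, of x y] by simp

lemma add_mem_iff: "y \<in> L \<Longrightarrow> x + y \<in> L \<longleftrightarrow> x \<in> L"
  using diff_mem[of "x + y" y] add_mem[of x y] by auto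

lemma finite_ball: "finite {w \<in> L. norm w \<le> R}"
  by (rule finite_ball_if_summable_inverse_cube[OF summable_inverse_cube]) simp

lemma summable_on_if_cube_bound:
  fixes f :: "complex \<Rightarrow> complex"
  assumes "\<And>w. w \<in> L \<Longrightarrow> R < norm w \<Longrightarrow> norm (f w) \<le> C / norm w ^ 3"
  shows "f summable_on L"
proof -
  have "f summable_on (L - {w \<in> L. norm w \<le> R})"
  proof (rule abs_summable_summable, rule summable_on_comparison_test)
    show "(\<lambda>w. C * (1 / norm w ^ 3)) summable_on (L - {w \<in> L. norm w \<le> R})"
      by (intro summable_on_cmult_right summable_on_subset[OF summable_inverse_cube]) auto
  qed (use assms in auto)
  moreover have "f summable_on {w \<in> L. norm w \<le> R}"
    using finite_ball by simp
  ultimately have "f summable_on ((L - {w \<in> L. norm w \<le> R}) \<union> {w \<in> L. norm w \<le> R})"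
    by (rule summable_on_union)
  also have "(L - {w \<in> L. norm w \<le> R}) \<union> {w \<in> L. norm w \<le> R} = L" by blast
  finally show ?thesis .
qed

lemma zeta_has_sum: "(zeta_term z has_sum lattice_zeta L z) L"
proof -
  have "zeta_term z summable_on L"
  proof (rule summable_on_if_cube_bound)
    fix w assume "w \<in> L" "2 * norm z < norm w"
    then show "norm (zeta_term z w) \<le> 2 * norm z ^ 2 / norm w ^ 3"
      using order_trans[of 0 "2 * norm z" "norm w"] by (intro norm_zeta_term_le) auto
  qed
  then show ?thesis unfolding lattice_zeta_def by (rule has_sum_infsum)
qed

lemma wp_has_sum: "(wp_term z has_sum lattice_wp L z) L"
proof -
  have "wp_term z summable_on L"
  proof (rule summable_on_if_cube_bound)
    fix w assume "w \<in> L" "2 * norm z < norm w"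
    then show "norm (wp_term z w) \<le> 10 * norm z / norm w ^ 3"
      using order_trans[of 0 "2 * norm z" "norm w"] by (intro norm_wp_term_le) auto
  qed
  then show ?thesis unfolding lattice_wp_def by (rule has_sum_infsum)
qed

section \<open>Translation and reflection of the lattice sums\<close>

lemma bij_diff: "\<omega> \<in> L \<Longrightarrow> bij_betw (\<lambda>w. w - \<omega>) L L"
  by (rule bij_betw_byWitness[where f' = "\<lambda>w. w + \<omega>"]) (auto intro: diff_mem add_mem)

lemma bij_reflect: "\<omega> \<in> L \<Longrightarrow> bij_betw (\<lambda>w. \<omega> - w) L L"
  by (rule bij_betw_byWitness[where f' = "\<lambda>w. \<omega> - w"]) (auto intro: diff_mem)

text \<open>With the convention \<^prop>\<open>1 / 0 = (0::complex)\<close> the term at \<open>w = 0\<close> supplies the principal part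
  \<open>1 / z\<close>, the series make sense at lattice points too, and the functional equations below hold
  at every point. In particular the quasi-period of \<open>\<omega>\<close> is the junk value
  \<open>lattice_zeta L \<omega>\<close>.\<close>

lemma wp_eq_0_if_mem:
  assumes "\<omega> \<in> L"
  shows "lattice_wp L \<omega> = 0"
proof -
  have "((\<lambda>w. wp_term \<omega> (\<omega> - w)) has_sum lattice_wp L \<omega>) L"
    using has_sum_reindex_bij_betw[OF bij_reflect[OF assms], of "wp_term \<omega>"] wp_has_sum by simp
  moreover have "wp_term \<omega> (\<omega> - w) = - wp_term \<omega> w" for w
    by (simp add: wp_term_def)
  ultimately have "((\<lambda>w. - wp_term \<omega> w) has_sum lattice_wp L \<omega>) L" by simp
  then have "(wp_term \<omega> has_sum - lattice_wp L \<omega>) L"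
    by (simp add: has_sum_uminus)
  from has_sum_unique[OF this wp_has_sum] show ?thesis by simp
qed

text \<open>Shifting the summation index by \<omega> turns the series at z into the one at z +
  \<omega>, up to the series at \<omega> and z times \<open>lattice_wp L \<omega>\<close>; the
  latter vanishes at a period.\<close>

lemma zeta_add_period:
  assumes "\<omega> \<in> L"
  shows "lattice_zeta L (z + \<omega>) = lattice_zeta L z + lattice_zeta L \<omega>"
proof -
  have eq: "1 / (w - \<omega>) = - (1 / (\<omega> - w))" for w
    by (metis divide_minus_right minus_diff_eq)
  have shift: "zeta_term z (w - \<omega>) =
      zeta_term (z + \<omega>) w - zeta_term \<omega> w + z * wp_term \<omega> w" for w
    unfolding zeta_term_def wp_term_def
    by (simp add: eq power2_commute[of w \<omega>] algebra_simps add_divide_distrib)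
  have "((\<lambda>w. zeta_term z (w - \<omega>)) has_sum lattice_zeta L z) L"
    using has_sum_reindex_bij_betw[OF bij_diff[OF assms], of "zeta_term z"] zeta_has_sum by simp
  moreover have "((\<lambda>w. zeta_term z (w - \<omega>)) has_sum
      (lattice_zeta L (z + \<omega>) - lattice_zeta L \<omega> + z * lattice_wp L \<omega>)) L"
    unfolding shift
    by (intro has_sum_add has_sum_diff_complex has_sum_cmult_right zeta_has_sum wp_has_sum)
  ultimately show ?thesis
    using has_sum_unique wp_eq_0_if_mem[OF assms] by fastforce
qed

lemma wp_add_period:
  assumes "\<omega> \<in> L"
  shows "lattice_wp L (z + \<omega>) = lattice_wp L z"
proof -
  have shift: "wp_term z (w - \<omega>) = wp_term (z + \<omega>) w - wp_term \<omega> w" for w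
    unfolding wp_term_def by (simp add: power2_commute[of w \<omega>] algebra_simps)
  have "((\<lambda>w. wp_term z (w - \<omega>)) has_sum lattice_wp L z) L"
    using has_sum_reindex_bij_betw[OF bij_diff[OF assms], of "wp_term z"] wp_has_sum by simp
  moreover have "((\<lambda>w. wp_term z (w - \<omega>)) has_sum (lattice_wp L (z + \<omega>) - lattice_wp L \<omega>)) L"
    unfolding shift by (intro has_sum_diff_complex wp_has_sum)
  ultimately show ?thesis
    using has_sum_unique wp_eq_0_if_mem[OF assms] by fastforce
qed

lemma zeta_minus: "lattice_zeta L (- z) = - lattice_zeta L z"
proof -
  have "((\<lambda>w. zeta_term (- z) (- w)) has_sum lattice_zeta L (- z)) L"
    using has_sum_reindex_bij_betw[OF bij_reflect[OF zero_mem], of "zeta_term (- z)"] zeta_has_sum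
    by simp
  moreover have "zeta_term (- z) (- w) = - zeta_term z w" for w
  proof -
    have "1 / (w - z) = - (1 / (z - w))"
      by (metis divide_minus_right minus_diff_eq)
    then show ?thesis by (simp add: zeta_term_def)
  qed
  ultimately have "((\<lambda>w. - zeta_term z w) has_sum lattice_zeta L (- z)) L" by simp
  then have "(zeta_term z has_sum - lattice_zeta L (- z)) L" by (simp add: has_sum_uminus)
  from has_sum_unique[OF this zeta_has_sum] show ?thesis by (metis minus_minus)
qed

end

subsection \<open>Analyticity in the argument\<close>

text \<open>The M-test makes the partial sums converge uniformly, and uniform limits of holomorphic
  functions are holomorphic.\<close>

lemma analytic_at_infsum:
  fixes f :: "'i \<Rightarrow> complex \<Rightarrow> complex"
  assumes "r > 0" "\<And>i. i \<in> I \<Longrightarrow> f i holomorphic_on ball z0 r"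
    and "\<And>i z. i \<in> I \<Longrightarrow> z \<in> ball z0 r \<Longrightarrow> norm (f i z) \<le> M i" "M summable_on I"
  shows "(\<lambda>z. \<Sum>\<^sub>\<infinity>i\<in>I. f i z) analytic_on {z0}"
proof -
  \<comment> \<open>A smaller closed ball, on which the partial sums are continuous up to the
    boundary.\<close>
  have sub: "cball z0 (r / 2) \<subseteq> ball z0 r" using assms(1) by (auto simp: dist_norm)
  have ulim: "uniform_limit (cball z0 (r / 2)) (\<lambda>X z. \<Sum>i\<in>X. f i z) (\<lambda>z. \<Sum>\<^sub>\<infinity>i\<in>I. f i z)
      (finite_subsets_at_top I)"
    using assms sub by (intro Weierstrass_m_test_general[of _ _ _ M]) auto
  have "\<forall>\<^sub>F X in finite_subsets_at_top I.
      continuous_on (cball z0 (r / 2)) (\<lambda>z. \<Sum>i\<in>X. f i z) \<and>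
      (\<lambda>z. \<Sum>i\<in>X. f i z) holomorphic_on ball z0 (r / 2)"
  proof (rule eventually_finite_subsets_at_top_weakI)
    fix X assume "finite X" "X \<subseteq> I"
    then have h: "(\<lambda>z. \<Sum>i\<in>X. f i z) holomorphic_on ball z0 r"
      using assms by (intro holomorphic_on_sum) auto
    have "continuous_on (cball z0 (r / 2)) (\<lambda>z. \<Sum>i\<in>X. f i z)"
      using continuous_on_subset[OF holomorphic_on_imp_continuous_on[OF h] sub] .
    moreover have "(\<lambda>z. \<Sum>i\<in>X. f i z) holomorphic_on ball z0 (r / 2)"
      by (rule holomorphic_on_subset[OF h]) (use sub ball_subset_cball in blast)
    ultimately show "continuous_on (cball z0 (r / 2)) (\<lambda>z. \<Sum>i\<in>X. f i z) \<and>
      (\<lambda>z. \<Sum>i\<in>X. f i z) holomorphic_on ball z0 (r / 2)" ..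
  qed
  from holomorphic_uniform_limit[OF this ulim finite_subsets_at_top_neq_bot]
  have "(\<lambda>z. \<Sum>\<^sub>\<infinity>i\<in>I. f i z) holomorphic_on ball z0 (r / 2)"
    by blast
  then show ?thesis
    using assms(1) by (auto simp: analytic_at intro!: exI[of _ "ball z0 (r / 2)"])
qed

lemma infsum_split_finite:
  fixes f :: "'i \<Rightarrow> complex"
  assumes "finite J" "J \<subseteq> I" "\<And>i. i \<in> I - J \<Longrightarrow> norm (f i) \<le> M i" "M summable_on (I - J)"
  shows "infsum f I = sum f J + infsum f (I - J)"
proof -
  have "f summable_on (I - J)"
    by (rule abs_summable_summable, rule summable_on_comparison_test[OF assms(4)])
       (use assms(3) in auto)
  then have "infsum f (J \<union> (I - J)) = infsum f J + infsum f (I - J)"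
    using assms(1) by (intro infsum_Un_disjoint) auto
  then show ?thesis using assms(1,2) by (simp add: Un_absorb1 infsum_finite)
qed

text \<open>The finitely many terms in J are split off; they alone decide whether the sum is
  analytic or has a pole at \<open>z0\<close>.\<close>

lemma
  fixes f :: "'i \<Rightarrow> complex \<Rightarrow> complex"
  assumes r: "r > 0" and J: "finite J" "J \<subseteq> I"
    and hol: "\<And>i. i \<in> I - J \<Longrightarrow> f i holomorphic_on ball z0 r"
    and bound: "\<And>i z. i \<in> I - J \<Longrightarrow> z \<in> ball z0 r \<Longrightarrow> norm (f i z) \<le> M i"
    and M: "M summable_on (I - J)"
  shows analytic_at_infsum_cofinite:
      "(\<And>i. i \<in> J \<Longrightarrow> f i analytic_on {z0}) \<Longrightarrow>
        (\<lambda>z. \<Sum>\<^sub>\<infinity>i\<in>I. f i z) analytic_on {z0}" (is "PROP ?A \<Longrightarrow> ?S analytic_on _")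
    and meromorphic_at_infsum_cofinite:
      "(\<And>i. i \<in> J \<Longrightarrow> f i meromorphic_on {z0}) \<Longrightarrow>
        (\<lambda>z. \<Sum>\<^sub>\<infinity>i\<in>I. f i z) meromorphic_on {z0}" (is "PROP ?B \<Longrightarrow> _")
proof -
  let ?T = "\<lambda>z. \<Sum>\<^sub>\<infinity>i\<in>I - J. f i z"
  have an: "?T analytic_on {z0}"
    using r hol bound M by (rule analytic_at_infsum)
  have eq: "?S z = (\<Sum>i\<in>J. f i z) + ?T z" if "z \<in> ball z0 r" for z
    using J bound[OF _ that] M by (rule infsum_split_finite)
  have ev: "eventually (\<lambda>z. ?S z = (\<Sum>i\<in>J. f i z) + ?T z) (nhds z0)"
    using eventually_nhds_in_open[of "ball z0 r" z0] r by (auto elim!: eventually_mono simp: eq)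
  { assume an_J: "PROP ?A"
    then have "(\<lambda>z. (\<Sum>i\<in>J. f i z) + ?T z) analytic_on {z0}"
      by (intro analytic_on_add analytic_on_sum an an_J)
    then show "?S analytic_on {z0}"
      using analytic_at_cong[OF ev refl] by blast }
  { assume mer_J: "PROP ?B"
    then have "(\<lambda>z. (\<Sum>i\<in>J. f i z) + ?T z) meromorphic_on {z0}"
      by (intro meromorphic_on_add meromorphic_on_sum analytic_on_imp_meromorphic_on[OF an] mer_J)
    moreover have "?S meromorphic_on {z0} \<longleftrightarrow>
        (\<lambda>z. (\<Sum>i\<in>J. f i z) + ?T z) meromorphic_on {z0}"
      by (rule meromorphic_on_cong[OF _ refl])
         (use ev in \<open>simp add: eventually_at_filter eventually_mono\<close>)
    ultimately show "?S meromorphic_on {z0}" by (rule iffD2[rotated]) }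
qed

context complex_lattice
begin

text \<open>Stated for a subset A so as to cover both the full series off L and, with A = L - {0},
  its regular part at the origin.\<close>

lemma
  assumes A: "A \<subseteq> L" and z0: "z0 \<notin> A"
  shows analytic_zeta_sum: "(\<lambda>z. \<Sum>\<^sub>\<infinity>w\<in>A. zeta_term z w) analytic_on {z0}"
    and analytic_wp_sum: "(\<lambda>z. \<Sum>\<^sub>\<infinity>w\<in>A. wp_term z w) analytic_on {z0}"
proof -
  define R where "R = norm z0 + 1"
  \<comment> \<open>Beyond radius 2R the term bounds hold on the whole unit ball about
    \<open>z0\<close>.\<close>
  define J where "J = {w \<in> A. norm w \<le> 2 * R}"
  have R: "R > 0" unfolding R_def by (simp add: add_nonneg_pos)
  have J: "finite J" "J \<subseteq> A"
    using finite_subset[OF _ finite_ball[of "2 * R"], of J] A by (auto simp: J_def)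
  have zR: "norm z \<le> R" if "z \<in> ball z0 1" for z
    using that norm_triangle_ineq2[of z z0] by (auto simp: R_def dist_norm norm_minus_commute)
  have big: "2 * R < norm w" "w \<noteq> 0" if "w \<in> A - J" for w
    using that R by (auto simp: J_def)
  have ne: "z - w \<noteq> 0" if "w \<in> A - J" "z \<in> ball z0 1" for w z
    using big(1)[OF that(1)] zR[OF that(2)] R by auto
  have M: "(\<lambda>w. C * (1 / norm w ^ 3)) summable_on (A - J)" for C
    using A by (intro summable_on_cmult_right summable_on_subset[OF summable_inverse_cube]) auto
  have J0: "z0 - w \<noteq> 0" if "w \<in> J" for w using that z0 J(2) by auto
  show "(\<lambda>z. \<Sum>\<^sub>\<infinity>w\<in>A. zeta_term z w) analytic_on {z0}"
  proof (rule analytic_at_infsum_cofinite[OF zero_less_one J _ _ M[of "2 * R ^ 2"]])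
    show "(\<lambda>z. zeta_term z w) holomorphic_on ball z0 1" if "w \<in> A - J" for w
      unfolding zeta_term_def using ne[OF that] big(2)[OF that] by (intro holomorphic_intros) auto
    show "norm (zeta_term z w) \<le> 2 * R ^ 2 * (1 / norm w ^ 3)" if "w \<in> A - J" "z \<in> ball z0 1" for w z
      using norm_zeta_term_le[OF zR[OF that(2)], of w] big[OF that(1)] by simp
    show "(\<lambda>z. zeta_term z w) analytic_on {z0}" if "w \<in> J" for w
    \<comment> \<open>For w = 0 the summands 1 / w and z / w^2 are 0 by convention and only 1 / z
      remains; otherwise their denominators are nonzero.\<close>
    proof (cases "w = 0")
      case True
      then show ?thesis unfolding zeta_term_def using J0[OF that] by (auto intro!: analytic_intros)
    next
      case False
      then show ?thesis unfolding zeta_term_def using J0[OF that] by (auto intro!: analytic_intros)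
    qed
  qed
  show "(\<lambda>z. \<Sum>\<^sub>\<infinity>w\<in>A. wp_term z w) analytic_on {z0}"
  proof (rule analytic_at_infsum_cofinite[OF zero_less_one J _ _ M[of "10 * R"]])
    show "(\<lambda>z. wp_term z w) holomorphic_on ball z0 1" if "w \<in> A - J" for w
      unfolding wp_term_def using ne[OF that] big(2)[OF that] by (intro holomorphic_intros) auto
    show "norm (wp_term z w) \<le> 10 * R * (1 / norm w ^ 3)" if "w \<in> A - J" "z \<in> ball z0 1" for w z
      using norm_wp_term_le[OF zR[OF that(2)], of w] big[OF that(1)] by simp
    show "(\<lambda>z. wp_term z w) analytic_on {z0}" if "w \<in> J" for w
      unfolding wp_term_def using J0[OF that] by (auto intro!: analytic_intros)
  qed
qed

lemma analytic_zeta: "z \<notin> L \<Longrightarrow> lattice_zeta L analytic_on {z}"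
  using analytic_zeta_sum[OF order_refl, of z] by (simp add: lattice_zeta_def[abs_def])

lemma analytic_wp: "z \<notin> L \<Longrightarrow> lattice_wp L analytic_on {z}"
  using analytic_wp_sum[OF order_refl, of z] by (simp add: lattice_wp_def[abs_def])

lemma zeta_split: "lattice_zeta L z = 1 / z + (\<Sum>\<^sub>\<infinity>w\<in>L - {0}. zeta_term z w)"
proof -
  have "zeta_term z summable_on L" using zeta_has_sum by (auto simp: summable_on_def)
  then have "infsum (zeta_term z) (insert 0 (L - {0})) =
      zeta_term z 0 + infsum (zeta_term z) (L - {0})"
    by (intro infsum_insert) (auto intro: summable_on_subset)
  moreover have "zeta_term z 0 = 1 / z" by (simp add: zeta_term_def)
  ultimately show ?thesis using zero_mem by (simp add: insert_absorb lattice_zeta_def)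
qed

lemma wp_split: "lattice_wp L z = 1 / z ^ 2 + (\<Sum>\<^sub>\<infinity>w\<in>L - {0}. wp_term z w)"
proof -
  have "wp_term z summable_on L" using wp_has_sum by (auto simp: summable_on_def)
  then have "infsum (wp_term z) (insert 0 (L - {0})) =
      wp_term z 0 + infsum (wp_term z) (L - {0})"
    by (intro infsum_insert) (auto intro: summable_on_subset)
  moreover have "wp_term z 0 = 1 / z ^ 2" by (simp add: wp_term_def)
  ultimately show ?thesis using zero_mem by (simp add: insert_absorb lattice_wp_def)
qed

lemma not_islimpt: "\<not> x islimpt L"
proof
  assume "x islimpt L"
  then have "x islimpt (L \<inter> ball x 1)"
    by (rule islimpt_Int_eventually) (rule eventually_at_in_open', auto)
  moreover have "finite (L \<inter> ball x 1)"
  proof (rule finite_subset[OF _ finite_ball[of "norm x + 1"]])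
    show "L \<inter> ball x 1 \<subseteq> {w \<in> L. norm w \<le> norm x + 1}"
    proof
      fix w assume "w \<in> L \<inter> ball x 1"
      then show "w \<in> {w \<in> L. norm w \<le> norm x + 1}"
        using norm_triangle_ineq2[of w x] by (simp add: dist_norm norm_minus_commute)
    qed
  qed
  ultimately show False by (simp add: islimpt_finite)
qed

lemma closed: "closed L"
  by (simp add: closed_limpt not_islimpt)

text \<open>The finite limit at 0 makes the singularity there removable, and periodicity carries
  this to all of L. The extension is entire with a bounded range, so Liouville's theorem
  applies.\<close>

lemma elliptic_constant:
  fixes F :: "complex \<Rightarrow> complex"
  assumes hol: "\<And>z. z \<notin> L \<Longrightarrow> F analytic_on {z}"
    and per: "\<And>z \<omega>. \<omega> \<in> L \<Longrightarrow> F (z + \<omega>) = F z"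
    and lim: "(F \<longlongrightarrow> c) (at 0)"
    and "z \<notin> L" "w \<notin> L"
  shows "F z = F w"
proof -
  define G where "G = (\<lambda>z. if z \<in> L then c else F z)"
  have perG: "G (z + \<omega>) = G z" if "\<omega> \<in> L" for z \<omega>
    using that by (simp add: G_def per add_mem_iff)
  have diff_off: "G field_differentiable (at z)" if "z \<notin> L" for z
  proof -
    have "\<forall>\<^sub>F w in nhds z. w \<in> - L"
      using closed that by (intro eventually_nhds_in_open) auto
    then have "\<forall>\<^sub>F w in nhds z. F w = G w" by (rule eventually_mono) (simp add: G_def)
    then have "G analytic_on {z}" using hol[OF that] analytic_at_cong by blast
    then show ?thesis using analytic_on_imp_differentiable_at by blast
  qed
  have "\<not> 0 islimpt L" by (rule not_islimpt)
  then obtain e where e: "e > 0" "\<And>w. w \<in> L \<Longrightarrow> w \<noteq> 0 \<Longrightarrow> e \<le> norm w"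
    unfolding islimpt_approachable by (auto simp: not_less)
  have ball: "w \<notin> L" if "w \<in> ball 0 e" "w \<noteq> 0" for w
    using e(2)[of w] that by (auto simp: dist_norm)
  have "G holomorphic_on ball 0 e"
  proof (rule no_isolated_singularity'[of "{0}"])
    have "\<forall>\<^sub>F w in at 0. F w = G w"
    proof (rule eventually_mono[OF eventually_at_in_open[of "ball 0 e" 0]])
      fix w :: complex assume "w \<in> ball 0 e - {0}"
      then show "F w = G w" using ball[of w] by (simp add: G_def)
    qed (use e in auto)
    then have "(G \<longlongrightarrow> c) (at 0)" using lim tendsto_cong by blast
    then have "(G \<longlongrightarrow> G 0) (at 0)" using zero_mem by (simp add: G_def)
    then have "(G \<longlongrightarrow> G 0) (at 0 within ball 0 e)"
      by (rule tendsto_within_subset) simp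
    then show "(G \<longlongrightarrow> G z) (at z within ball 0 e)" if "z \<in> {0}" for z
      using that by simp
    show "G holomorphic_on ball 0 e - {0}"
      using diff_off ball unfolding holomorphic_on_def
      by (auto intro: field_differentiable_at_within)
  qed auto
  then have d0: "G field_differentiable (at 0)"
    using e holomorphic_on_imp_differentiable_at[of G "ball 0 e" 0] by auto
  have "G field_differentiable (at z)" for z
  proof (cases "z \<in> L")
    case True
    \<comment> \<open>Translation by the period z carries differentiability at 0 to the lattice
      point z.\<close>
    have "(G \<circ> (\<lambda>w. w - z)) field_differentiable (at z)"
      by (rule field_differentiable_compose) (use d0 in \<open>auto intro!: derivative_intros\<close>)
    moreover have "G \<circ> (\<lambda>w. w - z) = G" using perG[OF uminus_mem[OF True]] by auto
    ultimately show ?thesis by simp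
  qed (rule diff_off)
  then have holG: "G holomorphic_on UNIV"
    by (simp add: holomorphic_on_def)
  obtain R where R: "\<And>z. \<exists>w\<in>L. norm (z - w) \<le> R" using cocompact by blast
  \<comment> \<open>By cocompactness every value is already taken on a fixed disc.\<close>
  have "range G \<subseteq> G ` cball 0 R"
  proof
    fix y assume "y \<in> range G"
    then obtain z where y: "y = G z" by blast
    obtain w where w: "w \<in> L" "norm (z - w) \<le> R" using R by blast
    have "y = G (z - w)" using perG[OF uminus_mem[OF w(1)]] y by auto
    then show "y \<in> G ` cball 0 R" using w by auto
  qed
  moreover have "compact (G ` cball 0 R)"
    by (intro compact_continuous_image continuous_on_subset[OF holomorphic_on_imp_continuous_on[OF holG]]) auto
  ultimately have "bounded (range G)" using bounded_subset compact_imp_bounded by blast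
  then have "G constant_on UNIV" using Liouville_theorem[OF holG] by blast
  then have "G z = G w" by (metis UNIV_I constant_on_def)
  then show ?thesis using assms by (simp add: G_def)
qed

text \<open>Identities (ii) and (iii) use the sublattice 2\<int> + 2\<int>\<sigma>, which is not of
  the form \<open>period_lattice\<close>.\<close>

lemma lattice_scale:
  assumes "c \<noteq> 0"
  shows "complex_lattice ((*) c ` L)"
proof
  show "0 \<in> (*) c ` L" using zero_mem by force
  show "x - y \<in> (*) c ` L" if xy: "x \<in> (*) c ` L" "y \<in> (*) c ` L" for x y
  proof -
    obtain x' y' where "x = c * x'" "y = c * y'" "x' \<in> L" "y' \<in> L" using xy by blast
    then have "x - y = c * (x' - y')" "x' - y' \<in> L" by (auto simp: algebra_simps diff_mem)
    then show ?thesis by blast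
  qed
  have "(\<lambda>w. 1 / norm c ^ 3 * (1 / norm w ^ 3)) summable_on L"
    by (intro summable_on_cmult_right summable_inverse_cube)
  then have "((\<lambda>w. 1 / norm w ^ 3) \<circ> (*) c) summable_on L"
    by (simp add: o_def norm_mult power_mult_distrib)
  moreover have "inj_on ((*) c) L" using assms by (auto simp: inj_on_def)
  ultimately show "(\<lambda>w. 1 / norm w ^ 3) summable_on (*) c ` L"
    using summable_on_reindex by blast
  obtain R where R: "\<And>z. \<exists>w\<in>L. norm (z - w) \<le> R" using cocompact by blast
  have "\<exists>w\<in>(*) c ` L. norm (z - w) \<le> norm c * R" for z
  proof -
    obtain w where w: "w \<in> L" "norm (z / c - w) \<le> R" using R by blast
    have "z - c * w = c * (z / c - w)" using assms by (simp add: algebra_simps)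
    then have "norm (z - c * w) \<le> norm c * R" using w by (simp add: norm_mult mult_left_mono)
    then show ?thesis using w by blast
  qed
  then show "\<exists>R. \<forall>z. \<exists>w\<in>(*) c ` L. norm (z - w) \<le> R" by blast
qed

end

lemma lattice_zeta_scale:
  assumes "c \<noteq> 0"
  shows "lattice_zeta ((*) c ` L) (c * z) = lattice_zeta L z / c"
proof -
  have inj: "inj_on ((*) c) L" using assms by (auto simp: inj_on_def)
  have "zeta_term (c * z) (c * w) = zeta_term z w * (1 / c)" for w
  proof -
    have "c * z - c * w = c * (z - w)" by (simp add: right_diff_distrib)
    then show ?thesis
      unfolding zeta_term_def using assms
      by (simp add: power2_eq_square add_divide_distrib mult.commute mult.left_commute)
  qed
  then have "lattice_zeta ((*) c ` L) (c * z) = (\<Sum>\<^sub>\<infinity>w\<in>L. zeta_term z w * (1 / c))"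
    unfolding lattice_zeta_def infsum_reindex[OF inj] by (simp add: o_def)
  also have "\<dots> = lattice_zeta L z / c"
    unfolding lattice_zeta_def by (subst infsum_cmult_left') simp
  finally show ?thesis .
qed

subsection \<open>Sublattices of index two\<close>

locale index_two_sublattice = L: complex_lattice L + M: complex_lattice M
  for L M :: "complex set" +
  fixes a :: complex
  assumes M_eq: "M = L \<union> (\<lambda>w. w + a) ` L"
    and a_notin: "a \<notin> L"
    and double_a: "2 * a \<in> L"
begin

lemma subset: "L \<subseteq> M" and a_mem: "a \<in> M"
  using M_eq L.zero_mem by force+

lemma disjoint: "L \<inter> (\<lambda>w. w - a) ` L = {}"
proof -
  have False if "w \<in> L" "v \<in> L" "w = v - a" for v w
    using L.diff_mem[OF that(2,1)] that(3) a_notin by simp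
  then show ?thesis by blast
qed

text \<open>L + a and L - a are the same coset because 2a lies in L. The form with a minus sign fits
  the index shift in \<open>zeta_relation\<close>.\<close>

lemma M_eq': "M = L \<union> (\<lambda>w. w - a) ` L"
proof -
  have "(\<lambda>w. w + a) ` L = (\<lambda>w. w - a) ` L"
  proof (intro equalityI image_subsetI)
    fix w assume w: "w \<in> L"
    have "w + a = (w + 2 * a) - a" "w - a = (w - 2 * a) + a" by simp_all
    then show "w + a \<in> (\<lambda>w. w - a) ` L" "w - a \<in> (\<lambda>w. w + a) ` L"
      using L.add_mem[OF w double_a] L.diff_mem[OF w double_a] by blast+
  qed
  then show ?thesis using M_eq by simp
qed

text \<open>The sum over M splits into the sum over L and the one over the coset L - a, which is
  re-expanded at x + a as in \<open>zeta_add_period\<close>. As a is not a period of L,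
  \<open>lattice_wp L a\<close> need not vanish, and a term linear in x stays.\<close>

lemma zeta_relation:
  "lattice_zeta L x + lattice_zeta L (x + a) - lattice_zeta M x
     = lattice_zeta L a - x * lattice_wp L a"
proof -
  have eq: "1 / (w - a) = - (1 / (a - w))" for w
    by (metis divide_minus_right minus_diff_eq)
  have shift: "zeta_term x (w - a) =
      zeta_term (x + a) w - zeta_term a w + x * wp_term a w" for w
    unfolding zeta_term_def wp_term_def
    by (simp add: eq power2_commute[of w a] algebra_simps add_divide_distrib)
  define S where "S = lattice_zeta L (x + a) - lattice_zeta L a + x * lattice_wp L a"
  have "((\<lambda>w. zeta_term x (w - a)) has_sum S) L"
    unfolding shift S_def
    by (intro has_sum_add has_sum_diff_complex has_sum_cmult_right L.zeta_has_sum L.wp_has_sum)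
  then have "(zeta_term x has_sum S) ((\<lambda>w. w - a) ` L)"
    by (subst has_sum_reindex) (auto simp: inj_on_def o_def)
  from has_sum_Un_disjoint[OF L.zeta_has_sum this disjoint]
  have "(zeta_term x has_sum (lattice_zeta L x + S)) M" unfolding M_eq' .
  from has_sum_unique[OF this M.zeta_has_sum] show ?thesis
    unfolding S_def by (simp add: algebra_simps)
qed

text \<open>Moving from -a to a by the period 2a, and using that zeta is odd.\<close>

lemma zeta_double_a: "lattice_zeta L (2 * a) = 2 * lattice_zeta L a"
  using L.zeta_add_period[OF double_a, of "- a"] L.zeta_minus[of a] by simp

text \<open>The constant is half the quasi-period of 2a; this choice makes the function odd and lets
  it change sign under translation by a.\<close>

definition \<phi> :: "complex \<Rightarrow> complex" where
  "\<phi> x = lattice_zeta L x - lattice_zeta L (x + a) + lattice_zeta L a"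

lemma \<phi>_period: "\<omega> \<in> L \<Longrightarrow> \<phi> (x + \<omega>) = \<phi> x"
  using L.zeta_add_period[of \<omega> x] L.zeta_add_period[of \<omega> "x + a"]
  by (simp add: \<phi>_def algebra_simps)

lemma \<phi>_half_period: "\<phi> (x + a) = - \<phi> x"
  using L.zeta_add_period[OF double_a, of x] zeta_double_a
  by (simp add: \<phi>_def algebra_simps)

lemma \<phi>_minus: "\<phi> (- x) = - \<phi> x"
  using L.zeta_add_period[OF double_a, of "- (x + a)"] zeta_double_a L.zeta_minus[of x]
    L.zeta_minus[of "x + a"]
  by (simp add: \<phi>_def algebra_simps)

lemma \<phi>_squared:
  assumes b: "b \<in> L" "b / 2 \<notin> M" and x: "x \<notin> M"
  shows "\<phi> x ^ 2 = lattice_wp M x - lattice_wp M (b / 2)"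
proof -
  define F where "F = (\<lambda>x. \<phi> x ^ 2 - lattice_wp M x)"
  \<comment> \<open>The part of \<open>\<phi>\<close> that is regular at 0; likewise
    \<open>p\<close> is the regular part of \<open>lattice_wp M\<close>.\<close>
  define h where "h = (\<lambda>z. (\<Sum>\<^sub>\<infinity>w\<in>L - {0}. zeta_term z w) - lattice_zeta L (z + a) + lattice_zeta L a)"
  define p where "p = (\<lambda>z. \<Sum>\<^sub>\<infinity>w\<in>M - {0}. wp_term z w)"
  have shift_an: "(\<lambda>z. lattice_zeta L (z + a)) analytic_on {z}" if "z + a \<notin> L" for z
  proof -
    have "(\<lambda>z. z + a) analytic_on {z}" by (intro analytic_intros)
    then have "(lattice_zeta L \<circ> (\<lambda>z. z + a)) analytic_on {z}"
      using L.analytic_zeta[OF that] by (intro analytic_on_compose) auto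
    then show ?thesis by (simp add: o_def)
  qed
  have h_an: "h analytic_on {0}"
    unfolding h_def using L.analytic_zeta_sum[of "L - {0}" 0] shift_an[of 0] a_notin
    by (intro analytic_intros) auto
  have p_an: "p analytic_on {0}"
    unfolding p_def by (rule M.analytic_wp_sum) auto
  \<comment> \<open>Without a constant term in \<open>\<phi>\<close> at 0, its square has no simple
    pole there.\<close>
  have "h 0 = 0"
  proof -
    have "(\<Sum>\<^sub>\<infinity>w\<in>L - {0}. zeta_term 0 w) = 0"
      by (rule infsum_0) (simp add: zeta_term_def)
    then show ?thesis by (simp add: h_def)
  qed
  moreover have h_diff: "(h has_field_derivative deriv h 0) (at 0)"
    using h_an analytic_on_imp_differentiable_at field_differentiable_derivI by blast
  ultimately have h_lim: "((\<lambda>z. h z / z) \<longlongrightarrow> deriv h 0) (at 0)"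
    by (simp add: DERIV_def)
  have "(h \<longlongrightarrow> 0) (at 0)"
    using DERIV_isCont[OF h_diff] \<open>h 0 = 0\<close> by (simp add: isCont_def)
  moreover have "(p \<longlongrightarrow> p 0) (at 0)"
    using analytic_at_imp_isCont[OF p_an] by (simp add: isCont_def)
  ultimately have "((\<lambda>z. 2 * (h z / z) + h z ^ 2 - p z) \<longlongrightarrow> 2 * deriv h 0 + 0 ^ 2 - p 0) (at 0)"
    using h_lim by (intro tendsto_intros)
  \<comment> \<open>The double poles cancel. With 1 / 0 = 0 the formula also holds at z = 0, so it
    is an equality of functions.\<close>
  moreover have "F = (\<lambda>z. 2 * (h z / z) + h z ^ 2 - p z)"
  proof
    fix z
    have "\<phi> z = 1 / z + h z" by (simp add: \<phi>_def h_def L.zeta_split)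
    moreover have "lattice_wp M z = 1 / z ^ 2 + p z" by (simp add: p_def M.wp_split)
    ultimately show "F z = 2 * (h z / z) + h z ^ 2 - p z"
      by (simp add: F_def power2_sum power_divide algebra_simps)
  qed
  ultimately have lim: "(F \<longlongrightarrow> 2 * deriv h 0 - p 0) (at 0)" by simp
  have an: "F analytic_on {z}" if "z \<notin> M" for z
  proof -
    have "z \<notin> L" using that subset by blast
    moreover have "z + a \<notin> L"
      using that M.diff_mem[OF _ a_mem, of "z + a"] subset by auto
    ultimately show ?thesis unfolding F_def \<phi>_def
      using L.analytic_zeta shift_an M.analytic_wp that by (intro analytic_intros) auto
  qed
  have per: "F (z + \<omega>) = F z" if "\<omega> \<in> M" for z \<omega>
  proof -
    \<comment> \<open>A period of M outside L only changes the sign of \<open>\<phi>\<close>, which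
      squaring removes.\<close>
    have "\<phi> (z + \<omega>) ^ 2 = \<phi> z ^ 2"
    proof (cases "\<omega> \<in> L")
      case False
      then obtain v where v: "v \<in> L" "\<omega> = v + a" using \<open>\<omega> \<in> M\<close> M_eq by blast
      have "\<phi> (z + \<omega>) = - \<phi> z"
        using \<phi>_half_period[of "z + v"] \<phi>_period[OF v(1)] v(2) by (simp add: add.assoc)
      then show ?thesis by simp
    qed (simp add: \<phi>_period)
    then show ?thesis by (simp add: F_def M.wp_add_period that)
  qed
  have "F x = F (b / 2)"
    by (rule M.elliptic_constant[OF an per lim x b(2)])
  \<comment> \<open>The points b / 2 and -b / 2 differ by the period b, and \<open>\<phi>\<close> is
    odd. This fixes the constant in F.\<close>
  moreover have "\<phi> (b / 2) = 0"
    using \<phi>_period[OF b(1), of "- (b / 2)"] \<phi>_minus[of "b / 2"] by simp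
  ultimately show ?thesis by (simp add: F_def algebra_simps)
qed

text \<open>\<open>zeta_relation\<close> at x, a and b produces multiples of
  \<open>lattice_wp L a\<close>; they cancel because u and v are the coordinates of x in terms of a
  and b.\<close>

lemma factorization:
  assumes b: "b \<in> L" "b / 2 \<notin> M" and x: "x \<notin> M" "x = u * a + v * b"
  shows "(lattice_zeta M x - u * lattice_zeta M a - v * lattice_zeta M b) ^ 2
      - lattice_wp M x + lattice_wp M (b / 2)
    = 4 * (lattice_zeta L x - u / 2 * lattice_zeta L (2 * a) - v * lattice_zeta L b)
        * (lattice_zeta L (x + a) - (u + 1) / 2 * lattice_zeta L (2 * a) - v * lattice_zeta L b)"
    (is "?Z ^ 2 - _ + _ = 4 * ?A * ?B")
proof -
  have a_rel: "lattice_zeta M a = 2 * lattice_zeta L a + a * lattice_wp L a"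
    using zeta_relation[of a] zeta_double_a by (simp add: algebra_simps)
  have b_rel: "lattice_zeta M b = 2 * lattice_zeta L b + b * lattice_wp L a"
    using zeta_relation[of b] L.zeta_add_period[OF b(1), of a] by (simp add: algebra_simps)
  have x_rel: "lattice_zeta M x = lattice_zeta L x + lattice_zeta L (x + a)
      - lattice_zeta L a + (u * a + v * b) * lattice_wp L a"
    using zeta_relation[of x] unfolding x(2)[symmetric] by (simp add: algebra_simps)
  \<comment> \<open>The coefficients u / 2 and (u + 1) / 2 add up to u + 1 / 2; the extra half of
    the quasi-period of 2a matches the term \<open>- lattice_zeta L a\<close> in
    \<open>x_rel\<close>.\<close>
  have sum: "?Z = ?A + ?B"
    unfolding a_rel b_rel x_rel zeta_double_a by (simp add: field_simps)
  have diff: "\<phi> x = ?A - ?B"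
    unfolding \<phi>_def zeta_double_a by (simp add: field_simps)
  have "4 * p * q = (p + q) ^ 2 - (p - q) ^ 2" for p q :: complex
    by (simp add: power2_eq_square algebra_simps)
  then have "4 * ?A * ?B = ?Z ^ 2 - \<phi> x ^ 2"
    unfolding sum diff .
  then show ?thesis using \<phi>_squared[OF b x(1)] by simp
qed

end

subsection \<open>The lattices \<open>\<int> + \<int>\<tau>\<close>\<close>

text \<open>Indexing by pairs of integers keeps the index set fixed while \<tau> varies.\<close>

definition lattice_point :: "complex \<Rightarrow> int \<times> int \<Rightarrow> complex" where
  "lattice_point \<tau> = (\<lambda>(m, n). of_int m + of_int n * \<tau>)"

lemma period_lattice_eq: "period_lattice \<tau> = range (lattice_point \<tau>)"
  unfolding period_lattice_def lattice_point_def by (auto simp: image_iff)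

lemma real_combination_mem_iff:
  assumes "Im \<tau> > 0"
  shows "of_real x + of_real y * \<tau> \<in> period_lattice \<tau> \<longleftrightarrow> x \<in> \<int> \<and> y \<in> \<int>"
proof
  assume "of_real x + of_real y * \<tau> \<in> period_lattice \<tau>"
  then obtain m n :: int where mn: "of_real x + of_real y * \<tau> = of_int m + of_int n * \<tau>"
    by (auto simp: period_lattice_def)
  have "y * Im \<tau> = real_of_int n * Im \<tau>" 
    using arg_cong[OF mn, of Im] by simp
  then have y: "y = of_int n" using assms by simp
  with mn have "complex_of_real x = of_real (of_int m)" by simp
  then have "x = of_int m" using of_real_eq_iff by blast
  then show "x \<in> \<int> \<and> y \<in> \<int>" using y by simp
next
  assume "x \<in> \<int> \<and> y \<in> \<int>"
  then obtain m n where "x = of_int m" "y = of_int n" by (auto elim!: Ints_cases)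
  then show "of_real x + of_real y * \<tau> \<in> period_lattice \<tau>" by (auto simp: period_lattice_def)
qed

lemma inj_lattice_point:
  assumes "Im \<tau> > 0"
  shows "inj (lattice_point \<tau>)"
proof (rule injI)
  fix i j assume eq: "lattice_point \<tau> i = lattice_point \<tau> j"
  obtain m n where i: "i = (m, n)" by (cases i)
  obtain m' n' where j: "j = (m', n')" by (cases j)
  have *: "complex_of_int m + of_int n * \<tau> = of_int m' + of_int n' * \<tau>"
    using eq by (simp add: lattice_point_def i j)
  from arg_cong[OF this, of Im] have "n = n'" using assms by simp
  with * show "i = j" by (simp add: i j)
qed

text \<open>The imaginary part of the point w is n Im \<tau>, which bounds n; then m = w - n \<tau>
  bounds m.\<close>

lemma lattice_point_lower_bound:
  assumes "Im \<tau> > 0"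
  obtains c where "c > 0" "\<And>m n. c * \<bar>of_int m\<bar> \<le> norm (lattice_point \<tau> (m, n))"
    "\<And>m n. c * \<bar>of_int n\<bar> \<le> norm (lattice_point \<tau> (m, n))"
proof -
  define y where "y = Im \<tau>"
  \<comment> \<open>The denominator is at least 1, for the bound on n, and at least y + |\<tau>|,
    for the bound on m.\<close>
  define c where "c = y / (y + 1 + norm \<tau>)"
  have y: "y > 0" using assms by (simp add: y_def)
  have d: "y + 1 + norm \<tau> > 0" using y by (simp add: add_pos_nonneg)
  have n: "y * \<bar>of_int n\<bar> \<le> norm (lattice_point \<tau> (m, n))" for m n
    using abs_Im_le_cmod[of "lattice_point \<tau> (m, n)"] y
    by (simp add: lattice_point_def y_def abs_mult mult.commute)
  have m: "\<bar>of_int m\<bar> \<le> norm (lattice_point \<tau> (m, n)) + \<bar>of_int n\<bar> * norm \<tau>" for m n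
  proof -
    have "complex_of_int m = lattice_point \<tau> (m, n) - of_int n * \<tau>"
      by (simp add: lattice_point_def)
    then have "norm (complex_of_int m) \<le> norm (lattice_point \<tau> (m, n)) + norm (of_int n * \<tau>)"
      by (metis norm_triangle_ineq4)
    then show ?thesis by (simp add: norm_mult)
  qed
  show thesis
  proof
    show "c > 0" using y d by (simp add: c_def)
    fix m n :: int
    let ?w = "norm (lattice_point \<tau> (m, n))"
    have "y * \<bar>of_int m\<bar> \<le> y * ?w + norm \<tau> * (y * \<bar>of_int n\<bar>)"
      using mult_left_mono[OF m[of m n], of y] y by (simp add: algebra_simps)
    also have "\<dots> \<le> y * ?w + norm \<tau> * ?w"
      using n[of n m] by (intro add_left_mono mult_left_mono) auto
    also have "\<dots> \<le> (y + 1 + norm \<tau>) * ?w" by (simp add: algebra_simps)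
    finally show "c * \<bar>of_int m\<bar> \<le> ?w"
      using d by (simp add: c_def field_simps)
    have "y * \<bar>of_int n\<bar> \<le> (y + 1 + norm \<tau>) * ?w"
      using n[of n m] y mult_right_mono[of 1 "y + 1 + norm \<tau>" ?w] by simp
    then show "c * \<bar>of_int n\<bar> \<le> ?w"
      using d by (simp add: c_def field_simps)
  qed
qed

text \<open>The exponent is half of 3 and still exceeds 1 in absolute value, so a product of two
  such series can dominate the double series. Taking the maximum with 1 keeps the base positive at m
  = 0.\<close>

lemma summable_on_int_powr:
  assumes "c > (0::real)"
  shows "(\<lambda>m::int. (c * max 1 \<bar>of_int m\<bar>) powr (-3/2)) summable_on UNIV"
proof -
  let ?q = "\<lambda>m::int. (c * max 1 \<bar>of_int m\<bar>) powr (-3/2)"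
  have "summable (\<lambda>n::nat. c powr (-3/2) * of_nat n powr (-3/2))"
    by (intro summable_mult) (simp add: summable_real_powr_iff)
  then have "summable (\<lambda>n::nat. (c * max 1 \<bar>real n\<bar>) powr (-3/2))"
  proof (rule summable_comparison_test_ev[rotated])
    show "\<forall>\<^sub>F n in sequentially. norm ((c * max 1 \<bar>real n\<bar>) powr (-3/2))
        \<le> c powr (-3/2) * of_nat n powr (-3/2)"
      using eventually_ge_at_top[of 1]
      by eventually_elim (use assms in \<open>simp add: powr_mult max_def\<close>)
  qed
  then have nat: "(\<lambda>n::nat. (c * max 1 \<bar>real n\<bar>) powr (-3/2)) summable_on UNIV"
    by (subst summable_on_UNIV_nonneg_real_iff) auto
  have "?q summable_on range int"
    by (subst summable_on_reindex) (use nat in \<open>auto simp: o_def\<close>)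
  moreover have "?q summable_on range (\<lambda>n. - int n)"
    by (subst summable_on_reindex) (use nat in \<open>auto simp: o_def inj_def\<close>)
  moreover have "range int \<union> range (\<lambda>n. - int n) = UNIV"
  proof -
    have "m \<in> range int \<union> range (\<lambda>n. - int n)" for m
      by (cases m rule: int_cases2) auto
    then show ?thesis by auto
  qed
  ultimately show ?thesis
    using summable_on_union[of ?q "range int" "range (\<lambda>n. - int n)"] by simp
qed

text \<open>Writing |w|^(-3) as a product of two powers with exponent -3/2 and estimating one
  through m and the other through n gives a majorant that factorizes.\<close>

lemma summable_inverse_cube_lattice_point:
  assumes "Im \<tau> > 0"
  shows "(\<lambda>i. 1 / norm (lattice_point \<tau> i) ^ 3) summable_on UNIV"
proof -
  obtain c where c: "c > 0" "\<And>m n. c * \<bar>of_int m\<bar> \<le> norm (lattice_point \<tau> (m, n))"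
    "\<And>m n. c * \<bar>of_int n\<bar> \<le> norm (lattice_point \<tau> (m, n))"
    using lattice_point_lower_bound[OF assms] by blast
  define q where "q = (\<lambda>m::int. (c * max 1 \<bar>of_int m\<bar>) powr (-3/2))"
  have q: "q summable_on UNIV" unfolding q_def by (rule summable_on_int_powr[OF c(1)])
  have "(\<lambda>(m, n). q m * q n) summable_on (SIGMA m:UNIV. UNIV)"
  proof (rule summable_on_SigmaI)
    show "((\<lambda>n. case (m, n) of (m, n) \<Rightarrow> q m * q n) has_sum q m * (\<Sum>\<^sub>\<infinity>n. q n)) UNIV" for m
      using q by (simp add: has_sum_cmult_right)
    show "(\<lambda>m. q m * (\<Sum>\<^sub>\<infinity>n. q n)) summable_on UNIV"
      using q by (rule summable_on_cmult_left)
  qed (simp add: q_def)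
  then have "(\<lambda>(m, n). q m * q n) summable_on UNIV" by simp
  then show ?thesis
  proof (rule summable_on_comparison_test)
    fix i :: "int \<times> int"
    obtain m n where i: "i = (m, n)" by (cases i)
    define w where "w = norm (lattice_point \<tau> (m, n))"
    show "1 / norm (lattice_point \<tau> i) ^ 3 \<le> (case i of (m, n) \<Rightarrow> q m * q n)"
    proof (cases "w = 0")
      case False
      then have w: "w > 0" by (simp add: w_def)
      \<comment> \<open>A nonzero point has norm at least c, which accounts for the maximum with 1
        in q.\<close>
      have "m \<noteq> 0 \<or> n \<noteq> 0" using w by (auto simp: w_def lattice_point_def)
      then have "1 \<le> \<bar>real_of_int m\<bar> \<or> 1 \<le> \<bar>real_of_int n\<bar>"
        by linarith
      then have "c \<le> c * \<bar>real_of_int m\<bar> \<or> c \<le> c * \<bar>real_of_int n\<bar>"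
        using c(1) by simp
      then have "c \<le> w" using c(2)[of m n] c(3)[of n m] by (auto simp: w_def)
      then have "c * max 1 \<bar>of_int m\<bar> \<le> w" "c * max 1 \<bar>of_int n\<bar> \<le> w"
        using c(2)[of m n] c(3)[of n m] by (auto simp: w_def max_def)
      then have "w powr (-3/2) * w powr (-3/2) \<le> q m * q n"
        unfolding q_def using c(1) by (intro mult_mono powr_mono2') auto
      moreover have "w powr (-3/2) * w powr (-3/2) = 1 / w ^ 3"
      proof -
        have "w powr (-3/2) * w powr (-3/2) = w powr (- 3)"
          by (subst powr_add[symmetric]) simp
        also have "\<dots> = inverse (w powr 3)" by (rule powr_minus)
        also have "\<dots> = 1 / w ^ 3" using w by (simp add: divide_inverse)
        finally show ?thesis .
      qed
      ultimately show ?thesis by (simp add: i w_def)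
    qed (auto simp: i w_def q_def)
  qed simp
qed

lemma complex_lattice_period_lattice:
  assumes "Im \<tau> > 0"
  shows "complex_lattice (period_lattice \<tau>)"
proof
  have "0 = of_int 0 + of_int 0 * \<tau>" by simp
  then show "0 \<in> period_lattice \<tau>" unfolding period_lattice_def by blast
  show "x - y \<in> period_lattice \<tau>" if xy: "x \<in> period_lattice \<tau>" "y \<in> period_lattice \<tau>" for x y
  proof -
    obtain m n m' n' :: int where "x = of_int m + of_int n * \<tau>" "y = of_int m' + of_int n' * \<tau>"
      using xy by (auto simp: period_lattice_def)
    then have "x - y = of_int (m - m') + of_int (n - n') * \<tau>" by (simp add: algebra_simps)
    then show ?thesis unfolding period_lattice_def by blast
  qed
  show "(\<lambda>w. 1 / norm w ^ 3) summable_on period_lattice \<tau>"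
    unfolding period_lattice_eq summable_on_reindex[OF inj_lattice_point[OF assms]]
    using summable_inverse_cube_lattice_point[OF assms] by (simp add: o_def)
  have "\<exists>w\<in>period_lattice \<tau>. norm (z - w) \<le> 1 + norm \<tau>" for z
  proof -
    \<comment> \<open>Real coordinates of z in the basis 1, \<tau>; rounding both down leaves a
      remainder in the fundamental parallelogram.\<close>
    define y where "y = Im z / Im \<tau>"
    define x where "x = Re z - y * Re \<tau>"
    have z: "z = of_real x + of_real y * \<tau>"
      using assms by (simp add: complex_eq_iff x_def y_def)
    define w where "w = of_int \<lfloor>x\<rfloor> + of_int \<lfloor>y\<rfloor> * \<tau>"
    have "z - w = of_real (x - of_int \<lfloor>x\<rfloor>) + of_real (y - of_int \<lfloor>y\<rfloor>) * \<tau>"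
      by (simp add: z w_def algebra_simps)
    then have "norm (z - w) \<le> \<bar>x - of_int \<lfloor>x\<rfloor>\<bar> + \<bar>y - of_int \<lfloor>y\<rfloor>\<bar> * norm \<tau>"
      by (metis norm_mult norm_of_real norm_triangle_ineq)
    also have "\<dots> \<le> 1 + 1 * norm \<tau>"
      by (intro add_mono mult_right_mono norm_ge_zero) linarith+
    finally have "norm (z - w) \<le> 1 + norm \<tau>" by simp
    moreover have "w \<in> period_lattice \<tau>" unfolding w_def period_lattice_def by blast
    ultimately show ?thesis by blast
  qed
  then show "\<exists>R. \<forall>z. \<exists>w\<in>period_lattice \<tau>. norm (z - w) \<le> R" by blast
qed

section \<open>The given functions as lattice sums\<close>

lemma weierstrass_zeta_eq:
  assumes "Im \<tau> > 0"
  shows "weierstrass_zeta z \<tau> = lattice_zeta (period_lattice \<tau>) z"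
  using complex_lattice.zeta_split[OF complex_lattice_period_lattice[OF assms]]
  by (simp add: weierstrass_zeta_def zeta_term_def)

lemma weierstrass_p_eq:
  assumes "Im \<tau> > 0"
  shows "weierstrass_p z \<tau> = lattice_wp (period_lattice \<tau>) z"
  using complex_lattice.wp_split[OF complex_lattice_period_lattice[OF assms]]
  by (simp add: weierstrass_p_def wp_term_def)

lemma period_lattice_memI: "of_int m + of_int n * \<tau> \<in> period_lattice \<tau>"
  unfolding period_lattice_def by blast

lemma one_mem: "1 \<in> period_lattice \<tau>" and tau_mem: "\<tau> \<in> period_lattice \<tau>"
  and one_plus_tau_mem: "1 + \<tau> \<in> period_lattice \<tau>"
  using period_lattice_memI[of 1 0 \<tau>] period_lattice_memI[of 0 1 \<tau>] period_lattice_memI[of 1 1 \<tau>]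
  by simp_all

lemma half_periods_notin:
  assumes "Im \<tau> > 0"
  shows "1 / 2 \<notin> period_lattice \<tau>" "\<tau> / 2 \<notin> period_lattice \<tau>" "(1 + \<tau>) / 2 \<notin> period_lattice \<tau>"
proof -
  have h: "(1 / 2 :: real) \<notin> \<int>"
  proof
    assume "(1 / 2 :: real) \<in> \<int>"
    then obtain k :: int where "1 / 2 = real_of_int k" by (auto elim: Ints_cases)
    then have "2 * k = 1" by linarith
    then show False by presburger
  qed
  show "1 / 2 \<notin> period_lattice \<tau>" "\<tau> / 2 \<notin> period_lattice \<tau>" "(1 + \<tau>) / 2 \<notin> period_lattice \<tau>"
    using real_combination_mem_iff[OF assms, of "1/2" 0] real_combination_mem_iff[OF assms, of 0 "1/2"]
      real_combination_mem_iff[OF assms, of "1/2" "1/2"] h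
    by (simp_all add: add_divide_distrib)
qed

lemma quasi_period_eq:
  assumes "Im \<tau> > 0"
  shows "quasi_period i \<tau> = lattice_zeta (period_lattice \<tau>) (omega i \<tau>)"
proof -
  interpret complex_lattice "period_lattice \<tau>"
    by (rule complex_lattice_period_lattice[OF assms])
  have mem: "omega i \<tau> \<in> period_lattice \<tau>"
    by (simp add: omega_def one_mem tau_mem one_plus_tau_mem)
  show ?thesis
    \<comment> \<open>Uniqueness needs one point off the lattice at which to evaluate, and 1 / 2 is
      such a point.\<close>
    unfolding quasi_period_def weierstrass_zeta_eq[OF assms] zeta_add_period[OF mem]
    using half_periods_notin(1)[OF assms] by (intro the_equality) auto
qed

lemma Z_eq:
  assumes "Im \<tau> > 0"
  shows "Z r s \<tau> = lattice_zeta (period_lattice \<tau>) (r + s * \<tau>)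
    - r * lattice_zeta (period_lattice \<tau>) 1 - s * lattice_zeta (period_lattice \<tau>) \<tau>"
  using assms by (simp add: Z_def weierstrass_zeta_eq quasi_period_eq omega_def)

lemma Zm_eq:
  assumes "Im \<tau> > 0"
  shows "Zm k r s \<tau> = (Z r s \<tau>) ^ 2 - lattice_wp (period_lattice \<tau>) (r + s * \<tau>)
    + lattice_wp (period_lattice \<tau>) (omega k \<tau> / 2)"
  using assms by (simp add: Zm_def e_val_def weierstrass_p_eq)

subsection \<open>Dependence on \<open>\<tau>\<close>\<close>

text \<open>So close to \<open>\<tau>0\<close> one has |\<tau> - \<tau>0| <= Im \<tau>. Hence the
  point moves by at most |n| Im \<tau>, the size of its own imaginary part. This makes estimates
  uniform in \<tau>.\<close>

lemma lattice_point_perturb: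
  assumes "norm (\<tau> - \<tau>0) < Im \<tau>0 / 2"
  shows "Im \<tau> > 0" "norm (lattice_point \<tau>0 i) \<le> 2 * norm (lattice_point \<tau> i)"
proof -
  obtain m n where i: "i = (m, n)" by (cases i)
  have "\<bar>Im \<tau> - Im \<tau>0\<bar> \<le> norm (\<tau> - \<tau>0)" using abs_Im_le_cmod[of "\<tau> - \<tau>0"] by simp
  then have le: "norm (\<tau> - \<tau>0) \<le> Im \<tau>" and pos: "Im \<tau> > 0"
    using assms norm_ge_zero[of "\<tau> - \<tau>0"] by linarith+
  show "Im \<tau> > 0" by (rule pos)
  have "lattice_point \<tau>0 i = lattice_point \<tau> i - of_int n * (\<tau> - \<tau>0)"
    by (simp add: lattice_point_def i algebra_simps)
  then have "norm (lattice_point \<tau>0 i) \<le> norm (lattice_point \<tau> i) + \<bar>of_int n\<bar> * norm (\<tau> - \<tau>0)"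
    by (metis norm_mult norm_of_int norm_triangle_ineq4)
  also have "\<bar>of_int n\<bar> * norm (\<tau> - \<tau>0) \<le> \<bar>of_int n\<bar> * Im \<tau>"
    using le by (intro mult_left_mono) auto
  also have "\<dots> \<le> norm (lattice_point \<tau> i)"
    using abs_Im_le_cmod[of "lattice_point \<tau> i"] pos by (simp add: lattice_point_def i abs_mult)
  finally show "norm (lattice_point \<tau>0 i) \<le> 2 * norm (lattice_point \<tau> i)" by simp
qed

lemma finite_lattice_point_ball:
  assumes "Im \<tau> > 0"
  shows "finite {i. norm (lattice_point \<tau> i) \<le> R}"
proof -
  have "finite {i \<in> UNIV. lattice_point \<tau> i = 0}"
    using finite_vimageI[OF _ inj_lattice_point[OF assms], of "{0}"] by (simp add: vimage_def)
  from finite_ball_if_summable_inverse_cube[OF summable_inverse_cube_lattice_point[OF assms] this]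
  show ?thesis by simp
qed

text \<open>Near \<open>t0\<close> all but finitely many terms are holomorphic with a common
  summable bound; the others are meromorphic one by one. The argument z may run through lattice
  points, as it does for quasi-periods: a vanishing denominator merely makes a quotient 0.\<close>

lemma
  assumes z: "z analytic_on {t0}" and T: "T analytic_on {t0}" and Im: "Im (T t0) > 0"
  shows meromorphic_weierstrass_zeta: "(\<lambda>t. weierstrass_zeta (z t) (T t)) meromorphic_on {t0}" (is ?goal_zeta)
    and meromorphic_weierstrass_p: "(\<lambda>t. weierstrass_p (z t) (T t)) meromorphic_on {t0}" (is ?goal_wp)
proof -
  define \<tau>0 where "\<tau>0 = T t0"
  define R where "R = norm (z t0) + 1"
  have R: "R > 0" unfolding R_def by (simp add: add_nonneg_pos)
  obtain e1 where e1: "e1 > 0" "z holomorphic_on ball t0 e1"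
    using z unfolding analytic_at_ball by auto
  obtain e2 where e2: "e2 > 0" "T holomorphic_on ball t0 e2"
    using T unfolding analytic_at_ball by auto
  have "isCont z t0" "isCont T t0" using analytic_at_imp_isCont[OF z] analytic_at_imp_isCont[OF T] .
  then have "\<forall>\<^sub>F t in nhds t0. dist (z t) (z t0) < 1 \<and> dist (T t) (T t0) < Im \<tau>0 / 2"
    using Im unfolding isCont_def
    by (intro eventually_conj tendstoD tendsto_at_iff_tendsto_nhds[THEN iffD1]) (auto simp: \<tau>0_def)
  then obtain e3 where e3: "e3 > 0" "\<And>t. dist t t0 < e3 \<Longrightarrow>
      dist (z t) (z t0) < 1 \<and> dist (T t) (T t0) < Im \<tau>0 / 2"
    unfolding eventually_nhds_metric by blast
  define r where "r = min e1 (min e2 e3)"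
  have r: "r > 0" using e1 e2 e3 by (simp add: r_def)
  have hol: "z holomorphic_on ball t0 r" "T holomorphic_on ball t0 r"
    using e1(2) e2(2) by (auto intro: holomorphic_on_subset simp: r_def)
  have zR: "norm (z t) \<le> R" and TT: "norm (T t - \<tau>0) < Im \<tau>0 / 2" if "t \<in> ball t0 r" for t
    using e3(2)[of t] that norm_triangle_ineq2[of "z t" "z t0"]
    by (auto simp: R_def r_def dist_norm \<tau>0_def norm_minus_commute)
  have ImT: "Im (T t) > 0" if "t \<in> ball t0 r" for t
    using lattice_point_perturb(1)[OF TT[OF that]] .
  \<comment> \<open>Passing from \<open>\<tau>0\<close> to T t costs a factor 2, so 4R leaves the
    threshold 2R of the term bounds.\<close>
  define J where "J = {i. norm (lattice_point \<tau>0 i) \<le> 4 * R}"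
  have J: "finite J" "J \<subseteq> UNIV"
    using finite_lattice_point_ball Im by (auto simp: J_def \<tau>0_def)
  have big: "2 * R < norm (lattice_point (T t) i)" "lattice_point (T t) i \<noteq> 0"
      "z t - lattice_point (T t) i \<noteq> 0"
    if "i \<in> UNIV - J" "t \<in> ball t0 r" for i t
  proof -
    show b: "2 * R < norm (lattice_point (T t) i)"
      using lattice_point_perturb(2)[OF TT[OF that(2)], of i] that(1) by (simp add: J_def)
    show "lattice_point (T t) i \<noteq> 0" "z t - lattice_point (T t) i \<noteq> 0"
      using b R zR[OF that(2)] by auto
  qed
  \<comment> \<open>The factor 8 is the cube of the 2 from
    \<open>lattice_point_perturb\<close>.\<close>
  have cube: "C / norm (lattice_point (T t) i) ^ 3 \<le> 8 * C * (1 / norm (lattice_point \<tau>0 i) ^ 3)"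
    if "i \<in> UNIV - J" "t \<in> ball t0 r" "C \<ge> 0" for i t C
  proof -
    have p: "norm (lattice_point \<tau>0 i) > 0" using that(1) R by (simp add: J_def del: zero_less_norm_iff)
    have "C / norm (lattice_point (T t) i) ^ 3 \<le> C / (norm (lattice_point \<tau>0 i) / 2) ^ 3"
      using lattice_point_perturb(2)[OF TT[OF that(2)], of i] that(3) p
      by (intro frac_le power_mono zero_less_power) auto
    then show ?thesis by (simp add: power_divide mult.commute)
  qed
  have M: "(\<lambda>i. C * (1 / norm (lattice_point \<tau>0 i) ^ 3)) summable_on (UNIV - J)" for C
    using Im by (intro summable_on_cmult_right
        summable_on_subset[OF summable_inverse_cube_lattice_point]) (auto simp: \<tau>0_def)
  have holL: "(\<lambda>t. lattice_point (T t) i) holomorphic_on ball t0 r" for i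
    unfolding lattice_point_def by (cases i) (auto intro!: holomorphic_intros hol)
  have merz: "z meromorphic_on {t0}" using z by (rule analytic_on_imp_meromorphic_on)
  have merL: "(\<lambda>t. lattice_point (T t) i) meromorphic_on {t0}" for i
    unfolding lattice_point_def
    by (cases i) (auto intro!: meromorphic_intros analytic_on_imp_meromorphic_on[OF T])
  have ev: "eventually (\<lambda>t. t \<in> ball t0 r) (at t0)"
    using r by (intro eventually_at_in_open') auto
  have cong: "f meromorphic_on {t0} \<longleftrightarrow> g meromorphic_on {t0}"
    if "\<And>t. t \<in> ball t0 r \<Longrightarrow> f t = g t" for f g :: "complex \<Rightarrow> complex"
  proof (rule meromorphic_on_cong[OF _ refl])
    fix t assume "t \<in> {t0}"
    then show "eventually (\<lambda>t. f t = g t) (at t)"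
      using eventually_mono[OF ev that] by simp
  qed
  have reindex: "infsum f (period_lattice (T t)) = (\<Sum>\<^sub>\<infinity>i. f (lattice_point (T t) i))"
    if "t \<in> ball t0 r" for f :: "complex \<Rightarrow> complex" and t
    unfolding period_lattice_eq infsum_reindex[OF inj_lattice_point[OF ImT[OF that]]]
    by (simp add: o_def)
  have "(\<lambda>t. \<Sum>\<^sub>\<infinity>i. zeta_term (z t) (lattice_point (T t) i)) meromorphic_on {t0}"
  proof (rule meromorphic_at_infsum_cofinite[OF r J _ _ M[of "8 * (2 * R ^ 2)"]])
    show "(\<lambda>t. zeta_term (z t) (lattice_point (T t) i)) holomorphic_on ball t0 r" if "i \<in> UNIV - J" for i
      unfolding zeta_term_def using big[OF that] by (intro holomorphic_intros hol holL) auto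
    show "norm (zeta_term (z t) (lattice_point (T t) i))
        \<le> 8 * (2 * R ^ 2) * (1 / norm (lattice_point \<tau>0 i) ^ 3)"
      if i: "i \<in> UNIV - J" "t \<in> ball t0 r" for i t
      using norm_zeta_term_le[OF zR[OF i(2)], of "lattice_point (T t) i"] big[OF i]
        cube[OF i, of "2 * R ^ 2"] by simp
    show "(\<lambda>t. zeta_term (z t) (lattice_point (T t) i)) meromorphic_on {t0}" for i
      unfolding zeta_term_def by (intro meromorphic_intros merz merL)
  qed
  also have "?this \<longleftrightarrow> ?goal_zeta"
    by (rule cong) (simp add: weierstrass_zeta_eq[OF ImT] lattice_zeta_def reindex)
  finally show ?goal_zeta .
  have "(\<lambda>t. \<Sum>\<^sub>\<infinity>i. wp_term (z t) (lattice_point (T t) i)) meromorphic_on {t0}"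
  proof (rule meromorphic_at_infsum_cofinite[OF r J _ _ M[of "8 * (10 * R)"]])
    show "(\<lambda>t. wp_term (z t) (lattice_point (T t) i)) holomorphic_on ball t0 r" if "i \<in> UNIV - J" for i
      unfolding wp_term_def using big[OF that] by (intro holomorphic_intros hol holL) auto
    show "norm (wp_term (z t) (lattice_point (T t) i))
        \<le> 8 * (10 * R) * (1 / norm (lattice_point \<tau>0 i) ^ 3)"
      if i: "i \<in> UNIV - J" "t \<in> ball t0 r" for i t
      using norm_wp_term_le[OF zR[OF i(2)], of "lattice_point (T t) i"] big[OF i]
        cube[OF i, of "10 * R"] R by simp
    show "(\<lambda>t. wp_term (z t) (lattice_point (T t) i)) meromorphic_on {t0}" for i
      unfolding wp_term_def by (intro meromorphic_intros merz merL)
  qed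
  also have "?this \<longleftrightarrow> ?goal_wp"
    by (rule cong) (simp add: weierstrass_p_eq[OF ImT] lattice_wp_def reindex)
  finally show ?goal_wp .
qed

section \<open>Meromorphy in \<tau> and the exceptional set\<close>

lemma open_upper_half_plane: "open upper_half_plane"
  by (simp add: upper_half_plane_def open_halfspace_Im_gt)

lemma
  assumes T: "T holomorphic_on upper_half_plane" "\<And>\<tau>. \<tau> \<in> upper_half_plane \<Longrightarrow> Im (T \<tau>) > 0"
  shows meromorphic_Z: "(\<lambda>\<tau>. Z r s (T \<tau>)) meromorphic_on upper_half_plane" (is ?goal_Z)
    and meromorphic_Zm: "(\<lambda>\<tau>. Zm k r s (T \<tau>)) meromorphic_on upper_half_plane" (is ?goal_Zm)
proof -
  have Tan: "T analytic_on {t}" if "t \<in> upper_half_plane" for t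
    using T(1) that open_upper_half_plane analytic_at by blast
  have zeta: "(\<lambda>\<tau>. weierstrass_zeta (a + b * T \<tau>) (T \<tau>)) meromorphic_on upper_half_plane"
    and wp: "(\<lambda>\<tau>. weierstrass_p (a + b * T \<tau>) (T \<tau>)) meromorphic_on upper_half_plane" for a b
  proof -
    have an: "(\<lambda>\<tau>. a + b * T \<tau>) analytic_on {t}" if "t \<in> upper_half_plane" for t
      using Tan[OF that] by (intro analytic_intros)
    show "(\<lambda>\<tau>. weierstrass_zeta (a + b * T \<tau>) (T \<tau>)) meromorphic_on upper_half_plane"
      "(\<lambda>\<tau>. weierstrass_p (a + b * T \<tau>) (T \<tau>)) meromorphic_on upper_half_plane"
      using meromorphic_weierstrass_zeta[OF an Tan T(2)] meromorphic_weierstrass_p[OF an Tan T(2)]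
      by (subst meromorphic_on_meromorphic_at, blast)+
  qed
  \<comment> \<open>The quasi-periods are the values of zeta at the lattice points 1 and \<tau>
    under the convention 1 / 0 = 0; writing these points as a + b T makes \<open>zeta\<close>
    applicable.\<close>
  have Z: "Z r s (T \<tau>) = weierstrass_zeta (r + s * T \<tau>) (T \<tau>)
      - r * weierstrass_zeta (1 + 0 * T \<tau>) (T \<tau>) - s * weierstrass_zeta (0 + 1 * T \<tau>) (T \<tau>)"
    if "\<tau> \<in> upper_half_plane" for \<tau>
    using T(2)[OF that] by (simp add: Z_eq weierstrass_zeta_eq)
  have "(\<lambda>\<tau>. weierstrass_zeta (r + s * T \<tau>) (T \<tau>)
      - r * weierstrass_zeta (1 + 0 * T \<tau>) (T \<tau>) - s * weierstrass_zeta (0 + 1 * T \<tau>) (T \<tau>))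
      meromorphic_on upper_half_plane"
    by (intro meromorphic_intros zeta)
  also have "?this \<longleftrightarrow> ?goal_Z"
  proof (rule meromorphic_on_cong[OF _ refl])
    fix t assume "t \<in> upper_half_plane"
    then have "eventually (\<lambda>\<tau>. \<tau> \<in> upper_half_plane) (at t)"
      using open_upper_half_plane by (rule eventually_at_in_open'[rotated])
    then show "\<forall>\<^sub>F \<tau> in at t. weierstrass_zeta (r + s * T \<tau>) (T \<tau>)
      - r * weierstrass_zeta (1 + 0 * T \<tau>) (T \<tau>) - s * weierstrass_zeta (0 + 1 * T \<tau>) (T \<tau>)
      = Z r s (T \<tau>)"
      by (rule eventually_mono) (simp only: Z)
  qed
  finally show Zmer: ?goal_Z .
  obtain a b where half: "omega k \<tau> / 2 = a + b * \<tau>" for \<tau>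
  proof (cases "k = 1"; cases "k = 2")
    assume "k \<noteq> 1" "k \<noteq> 2"
    then show thesis by (intro that[of "1/2" "1/2"]) (simp add: omega_def add_divide_distrib)
  next
    assume "k \<noteq> 1" "k = 2"
    then show thesis by (intro that[of 0 "1/2"]) (simp add: omega_def)
  qed (auto intro!: that[of "1/2" 0] simp: omega_def)
  show ?goal_Zm
    unfolding Zm_def e_val_def half by (intro meromorphic_intros Zmer wp)
qed

text \<open>For fixed (m, n) the condition is a linear equation in \<tau> that does not hold
  identically, so it has at most one solution. Near a given point r + s \<tau> is bounded, which
  leaves finitely many pairs.\<close>

lemma pole_set_sparse:
  assumes "\<not> (\<exists>m n :: int. r = of_int m \<and> s = of_int n)"
  shows "pole_set r s sparse_in upper_half_plane"
  unfolding sparse_in_open[OF open_upper_half_plane]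
proof (intro ballI notI)
  fix \<tau>0 assume \<tau>0: "\<tau>0 \<in> upper_half_plane" "\<tau>0 islimpt pole_set r s"
  define e where "e = Im \<tau>0 / 2"
  have e: "e > 0" using \<tau>0 by (simp add: e_def upper_half_plane_def)
  define R where "R = norm r + norm s * (norm \<tau>0 + e)"
  define J where "J = {i. norm (lattice_point \<tau>0 i) \<le> 2 * R}"
  have J: "finite J"
    using finite_lattice_point_ball \<tau>0 by (simp add: J_def upper_half_plane_def)
  have fin: "finite {\<tau>. r + s * \<tau> = lattice_point \<tau> i}" for i
  proof -
    obtain m n where i: "i = (m, n)" by (cases i)
    show ?thesis
    proof (cases "s = of_int n")
      case True
      then have "r \<noteq> of_int m" using assms by blast
      then show ?thesis by (simp add: True i lattice_point_def)
    next
      case False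
      have "{\<tau>. r + s * \<tau> = lattice_point \<tau> i} \<subseteq> {(of_int m - r) / (s - of_int n)}"
        using False by (auto simp: i lattice_point_def field_simps)
      then show ?thesis using finite_subset by blast
    qed
  qed
  have "pole_set r s \<inter> ball \<tau>0 e \<subseteq> (\<Union>i\<in>J. {\<tau>. r + s * \<tau> = lattice_point \<tau> i})"
  proof
    fix \<tau> assume \<tau>: "\<tau> \<in> pole_set r s \<inter> ball \<tau>0 e"
    then obtain i where i: "r + s * \<tau> = lattice_point \<tau> i"
      by (auto simp: pole_set_def period_lattice_eq)
    have d: "norm (\<tau> - \<tau>0) < e" using \<tau> by (simp add: dist_norm norm_minus_commute)
    have "norm \<tau> \<le> norm \<tau>0 + e" using d norm_triangle_ineq2[of \<tau> \<tau>0] by simp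
    then have "norm (lattice_point \<tau> i) \<le> R"
      unfolding i[symmetric] R_def
      by (intro norm_triangle_le add_left_mono) (simp add: norm_mult mult_left_mono)
    moreover have "norm (lattice_point \<tau>0 i) \<le> 2 * norm (lattice_point \<tau> i)"
      using d by (intro lattice_point_perturb(2)) (simp add: e_def)
    ultimately have "i \<in> J" by (simp add: J_def)
    then show "\<tau> \<in> (\<Union>i\<in>J. {\<tau>. r + s * \<tau> = lattice_point \<tau> i})" using i by blast
  qed
  then have "finite (pole_set r s \<inter> ball \<tau>0 e)"
    using J fin by (meson finite_UN_I finite_subset)
  moreover have "\<tau>0 islimpt (pole_set r s \<inter> ball \<tau>0 e)"
    using \<tau>0(2) by (rule islimpt_Int_eventually) (rule eventually_at_in_open', use e in auto)
  ultimately show False by (simp add: islimpt_finite)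
qed

subsection \<open>The three sublattices\<close>

text \<open>Lets (iii) be treated with the basis 1, 1 + \<tau> of the same lattice.\<close>

lemma period_lattice_one_plus: "period_lattice (1 + \<tau>) = period_lattice \<tau>"
proof -
  have "of_int m + of_int n * (1 + \<tau>) = of_int (m + n) + of_int n * \<tau>"
    and "of_int m + of_int n * \<tau> = of_int (m - n) + of_int n * (1 + \<tau>)" for m n
    by (simp_all add: algebra_simps)
  then show ?thesis unfolding period_lattice_def by (safe; blast)
qed

text \<open>The parity of one coordinate decides the coset in both index-two decompositions
  below.\<close>

lemma even_or_odd_int: obtains j :: int where "n = 2 * j" | j where "n = 2 * j + 1"
  by (metis evenE oddE)

lemma index_two_double_tau:
  assumes "Im \<tau> > 0"
  shows "index_two_sublattice (period_lattice (2 * \<tau>)) (period_lattice \<tau>) \<tau>"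
proof -
  have L: "complex_lattice (period_lattice (2 * \<tau>))" and M: "complex_lattice (period_lattice \<tau>)"
    using assms by (simp_all add: complex_lattice_period_lattice)
  have "period_lattice \<tau> = period_lattice (2 * \<tau>) \<union> (\<lambda>w. w + \<tau>) ` period_lattice (2 * \<tau>)"
  proof (intro equalityI subsetI)
    fix w assume "w \<in> period_lattice \<tau>"
    then obtain m n :: int where w: "w = of_int m + of_int n * \<tau>"
      by (auto simp: period_lattice_def)
    show "w \<in> period_lattice (2 * \<tau>) \<union> (\<lambda>w. w + \<tau>) ` period_lattice (2 * \<tau>)"
    proof (cases n rule: even_or_odd_int)
      case (1 j)
      then show ?thesis using period_lattice_memI[of m j "2 * \<tau>"] by (simp add: w algebra_simps)
    next
      case (2 j)
      then have "w = (of_int m + of_int j * (2 * \<tau>)) + \<tau>" by (simp add: w algebra_simps)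
      then show ?thesis using period_lattice_memI by blast
    qed
  next
    fix w assume "w \<in> period_lattice (2 * \<tau>) \<union> (\<lambda>w. w + \<tau>) ` period_lattice (2 * \<tau>)"
    then obtain m n :: int where "w = of_int m + of_int n * (2 * \<tau>) \<or>
        w = of_int m + of_int n * (2 * \<tau>) + \<tau>"
      by (auto simp: period_lattice_def)
    then have "w = of_int m + of_int (2 * n) * \<tau> \<or> w = of_int m + of_int (2 * n + 1) * \<tau>"
      by (auto simp: algebra_simps)
    then show "w \<in> period_lattice \<tau>" using period_lattice_memI by blast
  qed
  moreover have "\<tau> \<notin> period_lattice (2 * \<tau>)"
    using half_periods_notin(2)[of "2 * \<tau>"] assms by simp
  ultimately show ?thesis
    using L M tau_mem unfolding index_two_sublattice_def index_two_sublattice_axioms_def by blast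
qed

lemma index_two_double_one:
  assumes "Im \<sigma> > 0"
  shows "index_two_sublattice ((*) 2 ` period_lattice \<sigma>) (period_lattice (2 * \<sigma>)) 1"
proof -
  have L: "complex_lattice ((*) 2 ` period_lattice \<sigma>)" and M: "complex_lattice (period_lattice (2 * \<sigma>))"
    using assms by (simp_all add: complex_lattice_period_lattice complex_lattice.lattice_scale)
  have "period_lattice (2 * \<sigma>) = (*) 2 ` period_lattice \<sigma> \<union> (\<lambda>w. w + 1) ` (*) 2 ` period_lattice \<sigma>"
  proof (intro equalityI subsetI)
    fix w assume "w \<in> period_lattice (2 * \<sigma>)"
    then obtain m n :: int where w: "w = of_int m + of_int n * (2 * \<sigma>)"
      by (auto simp: period_lattice_def)
    show "w \<in> (*) 2 ` period_lattice \<sigma> \<union> (\<lambda>w. w + 1) ` (*) 2 ` period_lattice \<sigma>"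
    proof (cases m rule: even_or_odd_int)
      case (1 j)
      then have "w = 2 * (of_int j + of_int n * \<sigma>)" by (simp add: w algebra_simps)
      then show ?thesis using period_lattice_memI by blast
    next
      case (2 j)
      then have "w = 2 * (of_int j + of_int n * \<sigma>) + 1" by (simp add: w algebra_simps)
      then show ?thesis using period_lattice_memI by blast
    qed
  next
    fix w assume "w \<in> (*) 2 ` period_lattice \<sigma> \<union> (\<lambda>w. w + 1) ` (*) 2 ` period_lattice \<sigma>"
    then obtain v where v: "v \<in> period_lattice \<sigma>" "w = 2 * v \<or> w = 2 * v + 1"
      by blast
    then obtain m n :: int where "v = of_int m + of_int n * \<sigma>"
      by (auto simp: period_lattice_def)
    with v(2) have "w = of_int (2 * m) + of_int n * (2 * \<sigma>) \<or> w = of_int (2 * m + 1) + of_int n * (2 * \<sigma>)"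
      by (auto simp: algebra_simps)
    then show "w \<in> period_lattice (2 * \<sigma>)" using period_lattice_memI by blast
  qed
  moreover have "1 \<notin> (*) 2 ` period_lattice \<sigma>"
  proof
    assume "1 \<in> (*) 2 ` period_lattice \<sigma>"
    then obtain v where "v \<in> period_lattice \<sigma>" "1 = 2 * v" by blast
    moreover from this have "v = 1 / 2" by (simp add: field_simps)
    ultimately have "1 / 2 \<in> period_lattice \<sigma>" by simp
    then show False using half_periods_notin(1)[OF assms] by blast
  qed
  moreover have "2 * 1 \<in> (*) 2 ` period_lattice \<sigma>"
    using one_mem by blast
  ultimately show ?thesis
    using L M unfolding index_two_sublattice_def index_two_sublattice_axioms_def by blast
qed

text \<open>Here a = \<tau> and b = 1, so the coordinates in \<open>factorization\<close> are u = s
  and v = r. The sublattice already has the form \<open>period_lattice\<close>, so nothing is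
  rescaled and the factor 4 remains.\<close>

lemma Zm_1_factorization:
  assumes "Im \<tau> > 0" "r + s * \<tau> \<notin> period_lattice \<tau>"
  shows "Zm 1 r s \<tau> = 4 * Z r (s / 2) (2 * \<tau>) * Z r ((s + 1) / 2) (2 * \<tau>)"
proof -
  interpret index_two_sublattice "period_lattice (2 * \<tau>)" "period_lattice \<tau>" \<tau>
    by (rule index_two_double_tau[OF assms(1)])
  let ?L = "period_lattice (2 * \<tau>)"
  have im: "Im (2 * \<tau>) > 0" using assms(1) by simp
  have "r + (s + 1) / 2 * (2 * \<tau>) = r + s * \<tau> + \<tau>" "r + s / 2 * (2 * \<tau>) = r + s * \<tau>"
    by (simp_all add: field_simps)
  then have Z': "Z r (s / 2) (2 * \<tau>) = lattice_zeta ?L (r + s * \<tau>)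
      - s / 2 * lattice_zeta ?L (2 * \<tau>) - r * lattice_zeta ?L 1"
    "Z r ((s + 1) / 2) (2 * \<tau>) = lattice_zeta ?L (r + s * \<tau> + \<tau>)
      - (s + 1) / 2 * lattice_zeta ?L (2 * \<tau>) - r * lattice_zeta ?L 1"
    by (simp_all only: Z_eq[OF im]) (simp_all add: algebra_simps)
  have "Z r s \<tau> = lattice_zeta (period_lattice \<tau>) (r + s * \<tau>)
      - s * lattice_zeta (period_lattice \<tau>) \<tau> - r * lattice_zeta (period_lattice \<tau>) 1"
    by (simp add: Z_eq[OF assms(1)])
  then show ?thesis
    unfolding Z' Zm_eq[OF assms(1)]
    using factorization[OF one_mem half_periods_notin(1)[OF assms(1)] assms(2), of s r]
    by (simp add: omega_def)
qed

text \<open>Used with \<open>2\<sigma> = \<tau>\<close> and with \<open>2\<sigma> = 1 + \<tau>\<close>, which give the same lattice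
  \<open>M = \<int> + \<int>\<tau>\<close> but different sublattices \<open>2\<int> + 2\<int>\<sigma>\<close> of index two.\<close>

lemma Z_double_factorization:
  fixes M \<sigma> defines "M \<equiv> period_lattice (2 * \<sigma>)"
  assumes "Im \<sigma> > 0" "u + v * (2 * \<sigma>) \<notin> M"
  shows "(lattice_zeta M (u + v * (2 * \<sigma>)) - u * lattice_zeta M 1 - v * lattice_zeta M (2 * \<sigma>)) ^ 2
      - lattice_wp M (u + v * (2 * \<sigma>)) + lattice_wp M \<sigma>
    = Z (u / 2) v \<sigma> * Z ((u + 1) / 2) v \<sigma>"
proof -
  interpret index_two_sublattice "(*) 2 ` period_lattice \<sigma>" M 1
    unfolding M_def by (rule index_two_double_one[OF assms(2)])
  have mem: "2 * \<sigma> \<in> (*) 2 ` period_lattice \<sigma>" using tau_mem by blast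
  have half: "2 * \<sigma> / 2 \<notin> M"
    using half_periods_notin(2)[of "2 * \<sigma>"] assms(2) by (simp add: M_def)
  let ?L = "(*) 2 ` period_lattice \<sigma>"
  have unscale: "lattice_zeta (period_lattice \<sigma>) w = 2 * lattice_zeta ?L (2 * w)" for w
    using lattice_zeta_scale[of 2 "period_lattice \<sigma>" w] by (simp add: mult.commute)
  have "2 * (u / 2 + v * \<sigma>) = u + v * (2 * \<sigma>)"
    "2 * ((u + 1) / 2 + v * \<sigma>) = u + v * (2 * \<sigma>) + 1"
    by (simp_all add: field_simps)
  then have Z': "Z (u / 2) v \<sigma> = 2 * (lattice_zeta ?L (u + v * (2 * \<sigma>))
      - u / 2 * lattice_zeta ?L (2 * 1) - v * lattice_zeta ?L (2 * \<sigma>))"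
    "Z ((u + 1) / 2) v \<sigma> = 2 * (lattice_zeta ?L (u + v * (2 * \<sigma>) + 1)
      - (u + 1) / 2 * lattice_zeta ?L (2 * 1) - v * lattice_zeta ?L (2 * \<sigma>))"
    by (simp_all only: Z_eq[OF assms(2)] unscale) (simp_all add: algebra_simps)
  \<comment> \<open>Zeta is homogeneous of degree -1, so undoing the scaling by 2 gives each factor
    a 2; together they absorb the 4 of \<open>factorization\<close>.\<close>
  have four: "2 * p * (2 * q) = 4 * p * q" for p q :: complex by simp
  have "2 * \<sigma> / 2 = \<sigma>" "u + v * (2 * \<sigma>) = u * 1 + v * (2 * \<sigma>)" by simp_all
  then show ?thesis
    using factorization[OF mem half assms(3), of u v] unfolding Z' four by simp
qed

lemma Zm_2_factorization:
  assumes "Im \<tau> > 0" "r + s * \<tau> \<notin> period_lattice \<tau>"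
  shows "Zm 2 r s \<tau> = Z (r / 2) s (\<tau> / 2) * Z ((r + 1) / 2) s (\<tau> / 2)"
  using Z_double_factorization[of "\<tau> / 2" r s] assms by (simp add: Zm_eq Z_eq omega_def)

text \<open>In the basis 1, 1 + \<tau> the point r + s \<tau> has coordinates r - s and s, and
  additivity of the quasi-periods rewrites Z accordingly.\<close>

lemma Zm_3_factorization:
  assumes "Im \<tau> > 0" "r + s * \<tau> \<notin> period_lattice \<tau>"
  shows "Zm 3 r s \<tau> = Z ((r - s) / 2) s ((1 + \<tau>) / 2) * Z ((r - s + 1) / 2) s ((1 + \<tau>) / 2)"
proof -
  interpret complex_lattice "period_lattice \<tau>"
    by (rule complex_lattice_period_lattice[OF assms(1)])
  have x: "r - s + s * (1 + \<tau>) = r + s * \<tau>" by (simp add: algebra_simps)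
  have "lattice_zeta (period_lattice \<tau>) (1 + \<tau>)
      = lattice_zeta (period_lattice \<tau>) 1 + lattice_zeta (period_lattice \<tau>) \<tau>"
    by (rule zeta_add_period[OF tau_mem])
  then have "Z r s \<tau> = lattice_zeta (period_lattice \<tau>) (r + s * \<tau>)
      - (r - s) * lattice_zeta (period_lattice \<tau>) 1 - s * lattice_zeta (period_lattice \<tau>) (1 + \<tau>)"
    using assms(1) by (simp add: Z_eq algebra_simps)
  moreover have two: "2 * ((1 + \<tau>) / 2) = 1 + \<tau>" by simp
  moreover have "Im ((1 + \<tau>) / 2) > 0" using assms(1) by simp
  ultimately show ?thesis
    using Z_double_factorization[of "(1 + \<tau>) / 2" "r - s" s,
        unfolded two period_lattice_one_plus x] assms
    by (simp add: Zm_eq omega_def)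
qed

theorem lemma6p6:
  fixes r s :: complex
  assumes "\<not> (\<exists>m n :: int. r = of_int m / 2 \<and> s = of_int n / 2)"
  shows "meromorphic_identity upper_half_plane (pole_set r s)
           (\<lambda>\<tau>. Zm 1 r s \<tau>)
           (\<lambda>\<tau>. 4 * Z r (s / 2) (2 * \<tau>) * Z r ((s + 1) / 2) (2 * \<tau>))
       \<and> meromorphic_identity upper_half_plane (pole_set r s)
           (\<lambda>\<tau>. Zm 2 r s \<tau>)
           (\<lambda>\<tau>. Z (r / 2) s (\<tau> / 2) * Z ((r + 1) / 2) s (\<tau> / 2))
       \<and> meromorphic_identity upper_half_plane (pole_set r s)
           (\<lambda>\<tau>. Zm 3 r s \<tau>)
           (\<lambda>\<tau>. Z ((r - s) / 2) s ((1 + \<tau>) / 2) * Z ((r - s + 1) / 2) s ((1 + \<tau>) / 2))"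
proof -
  \<comment> \<open>Integers are half-integers with even numerator. Hence r + s \<tau> is not the
    same integral combination of 1 and \<tau> for every \<tau>.\<close>
  have "\<not> (\<exists>m n :: int. r = of_int m \<and> s = of_int n)"
  proof
    assume "\<exists>m n :: int. r = of_int m \<and> s = of_int n"
    then obtain m n :: int where "r = of_int m" "s = of_int n" by blast
    then have "r = of_int (2 * m) / 2 \<and> s = of_int (2 * n) / 2" by simp
    then show False using assms by blast
  qed
  then have sparse: "pole_set r s sparse_in upper_half_plane" by (rule pole_set_sparse)
  have Zm_mer: "(\<lambda>\<tau>. Zm k r s \<tau>) meromorphic_on upper_half_plane" for k
    by (rule meromorphic_Zm) (auto simp: upper_half_plane_def intro!: holomorphic_intros)
  have Z_mer: "(\<lambda>\<tau>. Z a b (2 * \<tau>)) meromorphic_on upper_half_plane"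
    "(\<lambda>\<tau>. Z a b (\<tau> / 2)) meromorphic_on upper_half_plane"
    "(\<lambda>\<tau>. Z a b ((1 + \<tau>) / 2)) meromorphic_on upper_half_plane" for a b
    by (rule meromorphic_Z; auto simp: upper_half_plane_def intro!: holomorphic_intros)+
  have off: "Im \<tau> > 0" "r + s * \<tau> \<notin> period_lattice \<tau>" if "\<tau> \<in> upper_half_plane - pole_set r s" for \<tau>
    using that by (auto simp: upper_half_plane_def pole_set_def)
  show ?thesis
    unfolding meromorphic_identity_def
    using sparse Zm_1_factorization[OF off] Zm_2_factorization[OF off] Zm_3_factorization[OF off]
    by (intro conjI ballI Zm_mer meromorphic_intros Z_mer) auto
qed

end
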